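(* Let $\|\cdot\|_Z$ be a strictly monotone norm on $\mathbb{R}^2$. Suppose $X$ is a Banach space with the weak fixed point property (WFPP) and $Y$ is a finite-dimensional Banach space. Then the direct sum $X\oplus_Z Y$ has the weak fixed point property.
   Context: A mapping $T:C\to C$ on a subset $C$ of a Banach space is nonexpansive if $\|Tx-Ty\|\le\|x-y\|$ for all $x,y\in C$. A Banach space has the weak fixed point property (WFPP) if every nonexpansive self-mapping of a nonempty weakly compact convex subset of it has a fixed point. A norm $\|\cdot\|$ on $\mathbb{R}^2$ is strictly monotone if $\|(x_1,y_1)\|<\|(x_2,y_2)\|$ whenever either $0\le x_1\le x_2$ and $0\le y_1<y_2$, or $0\le x_1<x_2$ and $0\le y_1\le y_2$. For a normed space $Z=(\mathbb{R}^2,\|\cdot\|_Z)$ and Banach spaces $X,Y$, $X\oplus_Z Y$ denotes $X\times Y$ with the norm $\|(x,y)\|=\|(\|x\|,\|y\|)\|_Z$. *)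

theory Defs
  imports "HOL-Analysis.Analysis"
begin

text \<open>
  The norm of \<open>X \<oplus>\<^sub>Z Y\<close> depends on the norm of \<open>Z\<close>, so it cannot be
  attached to the product type as a class instance.  Norms are therefore treated
  as functions on a real vector space, and the Banach space notions are relative to such a
  function; a space \<open>X\<close> given by a type of class \<open>banach\<close> is used with its own \<open>norm\<close>.
\<close>

definition is_norm :: "('v::real_vector \<Rightarrow> real) \<Rightarrow> bool" where
  "is_norm N \<longleftrightarrow>
     (\<forall>x. 0 \<le> N x) \<and> (\<forall>x. N x = 0 \<longleftrightarrow> x = 0) \<and>
     (\<forall>x y. N (x + y) \<le> N x + N y) \<and> (\<forall>c x. N (c *\<^sub>R x) = \<bar>c\<bar> * N x)"

definition is_banach_norm :: "('v::real_vector \<Rightarrow> real) \<Rightarrow> bool" where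
  "is_banach_norm N \<longleftrightarrow>
     is_norm N \<and> Metric_space.mcomplete UNIV (\<lambda>x y. N (x - y))"

definition dual_space :: "('v::real_vector \<Rightarrow> real) \<Rightarrow> ('v \<Rightarrow> real) set" where
  "dual_space N = {f. linear f \<and> (\<exists>K. \<forall>x. \<bar>f x\<bar> \<le> K * N x)}"

definition weak_topology :: "('v::real_vector \<Rightarrow> real) \<Rightarrow> 'v topology" where
  "weak_topology N = topology_generated_by {f -` U | f U. f \<in> dual_space N \<and> open U}"

definition nonexpansive_on ::
    "('v::real_vector \<Rightarrow> real) \<Rightarrow> 'v set \<Rightarrow> ('v \<Rightarrow> 'v) \<Rightarrow> bool" where
  "nonexpansive_on N C T \<longleftrightarrow> (\<forall>x\<in>C. \<forall>y\<in>C. N (T x - T y) \<le> N (x - y))"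

definition wfpp :: "('v::real_vector \<Rightarrow> real) \<Rightarrow> bool" where
  "wfpp N \<longleftrightarrow>
     (\<forall>C T. C \<noteq> {} \<and> convex C \<and> compactin (weak_topology N) C \<and>
            T \<in> C \<rightarrow> C \<and> nonexpansive_on N C T \<longrightarrow> (\<exists>x\<in>C. T x = x))"

definition strictly_monotone :: "(real \<times> real \<Rightarrow> real) \<Rightarrow> bool" where
  "strictly_monotone N \<longleftrightarrow>
     (\<forall>x1 x2 y1 y2.
        (0 \<le> x1 \<and> x1 \<le> x2 \<and> 0 \<le> y1 \<and> y1 < y2) \<or>
        (0 \<le> x1 \<and> x1 < x2 \<and> 0 \<le> y1 \<and> y1 \<le> y2)
        \<longrightarrow> N (x1, y1) < N (x2, y2))"

definition direct_sum_norm ::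
    "(real \<times> real \<Rightarrow> real) \<Rightarrow> 'a::real_normed_vector \<times> 'b::real_normed_vector \<Rightarrow> real" where
  "direct_sum_norm Z = (\<lambda>(x, y). Z (norm x, norm y))"

text \<open>Consistency of the definitions with the library and with each other.\<close>

lemma dual_space_norm: "dual_space norm = {f. bounded_linear f}"
proof (intro set_eqI iffI; clarsimp simp: dual_space_def)
  fix f :: "'a \<Rightarrow> real" and K assume "linear f" "\<forall>x. \<bar>f x\<bar> \<le> K * norm x"
  then show "bounded_linear f"
    by (auto simp: bounded_linear_def bounded_linear_axioms_def mult.commute)
next
  fix f :: "'a \<Rightarrow> real" assume f: "bounded_linear f"
  then obtain K where "\<forall>x. norm (f x) \<le> norm x * K"
    using bounded_linear.bounded by blast
  with f show "linear f \<and> (\<exists>K. \<forall>x. \<bar>f x\<bar> \<le> K * norm x)"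
    by (auto simp: mult.commute bounded_linear.linear)
qed

lemma topspace_weak_topology [simp]: "topspace (weak_topology N) = UNIV"
  if "is_norm N" for N :: "'v::real_vector \<Rightarrow> real"
proof -
  have "(\<lambda>x::'v. 0::real) \<in> dual_space N"
    by (auto simp: dual_space_def linear_iff intro: exI[of _ 0])
  then have "(\<lambda>x::'v. 0::real) -` UNIV \<in> {f -` U | f U. f \<in> dual_space N \<and> open U}"
    by blast
  then show ?thesis
    unfolding weak_topology_def topology_generated_by_topspace by auto
qed

lemma direct_sum_norm_mono:
  assumes "strictly_monotone Z" "0 \<le> a" "a \<le> c" "0 \<le> b" "b \<le> d"
  shows "Z (a, b) \<le> Z (c, d)"
proof (cases "b < d \<or> a < c")
  case True
  then show ?thesis
    using assms(2-) assms(1)[unfolded strictly_monotone_def, rule_format, of a c b d] by auto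
next
  case False
  then show ?thesis using assms by auto
qed

lemma is_norm_direct_sum_norm:
  assumes Z: "is_norm Z" and mono: "strictly_monotone Z"
  shows "is_norm (direct_sum_norm Z :: 'a::real_normed_vector \<times> 'b::real_normed_vector \<Rightarrow> real)"
  unfolding is_norm_def
proof (intro conjI allI)
  fix p q :: "'a \<times> 'b" and c :: real
  obtain x y where p: "p = (x, y)" by fastforce
  obtain u v where q: "q = (u, v)" by fastforce
  show "0 \<le> direct_sum_norm Z p"
    using Z by (simp add: is_norm_def direct_sum_norm_def p)
  show "direct_sum_norm Z p = 0 \<longleftrightarrow> p = 0"
    using Z by (simp add: is_norm_def direct_sum_norm_def p zero_prod_def)
  have "direct_sum_norm Z (p + q) \<le> Z (norm x + norm u, norm y + norm v)"
    unfolding direct_sum_norm_def p q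
    by (auto intro!: direct_sum_norm_mono[OF mono] norm_triangle_ineq)
  also have "\<dots> \<le> direct_sum_norm Z p + direct_sum_norm Z q"
  proof -
    have "Z ((norm x, norm y) + (norm u, norm v)) \<le> Z (norm x, norm y) + Z (norm u, norm v)"
      using Z unfolding is_norm_def by blast
    then show ?thesis by (simp add: direct_sum_norm_def p q)
  qed
  finally show "direct_sum_norm Z (p + q) \<le> direct_sum_norm Z p + direct_sum_norm Z q" .
  have "Z (\<bar>c\<bar> *\<^sub>R (norm x, norm y)) = \<bar>c\<bar> * Z (norm x, norm y)"
    using Z unfolding is_norm_def by simp
  then show "direct_sum_norm Z (c *\<^sub>R p) = \<bar>c\<bar> * direct_sum_norm Z p"
    by (simp add: direct_sum_norm_def p)
qed

lemma metric_of_norm: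
  assumes "is_norm N"
  shows "Metric_space UNIV (\<lambda>x y. N (x - y))"
proof
  fix x y z
  show "0 \<le> N (x - y)" using assms by (simp add: is_norm_def)
  have "N (- 1 *\<^sub>R (x - y)) = \<bar>- 1\<bar> * N (x - y)"
    using assms unfolding is_norm_def by blast
  then show "N (x - y) = N (y - x)" by simp
  show "N (x - y) = 0 \<longleftrightarrow> x = y" using assms by (simp add: is_norm_def)
  have "N ((x - y) + (y - z)) \<le> N (x - y) + N (y - z)"
    using assms unfolding is_norm_def by blast
  then show "N (x - z) \<le> N (x - y) + N (y - z)" by simp
qed

lemma is_banach_norm_norm: "is_banach_norm (norm :: 'a::banach \<Rightarrow> real)"
proof -
  have "is_norm (norm :: 'a \<Rightarrow> real)"
    by (auto simp: is_norm_def norm_triangle_ineq)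
  moreover have "(\<lambda>x y::'a. norm (x - y)) = dist"
    by (simp add: dist_norm fun_eq_iff)
  moreover have "Metric_space.mcomplete (UNIV :: 'a set) dist"
    using complete_UNIV by (simp only: mcomplete_iff_complete)
  ultimately show ?thesis
    by (simp add: is_banach_norm_def)
qed

lemma is_banach_norm_direct_sum_norm:
  assumes Z: "is_norm Z" and mono: "strictly_monotone Z"
  shows "is_banach_norm (direct_sum_norm Z :: 'a::banach \<times> 'b::banach \<Rightarrow> real)"
proof -
  let ?N = "direct_sum_norm Z :: 'a \<times> 'b \<Rightarrow> real"
  define a where "a = Z (1, 0)"
  define b where "b = Z (0, 1)"
  have nN: "is_norm ?N" using is_norm_direct_sum_norm[OF assms] .
  interpret M: Metric_space UNIV "\<lambda>p q. ?N (p - q)"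
    using metric_of_norm[OF nN] .
  have Zs: "Z (c *\<^sub>R p) = \<bar>c\<bar> * Z p" for c p
    using Z unfolding is_norm_def by blast
  have Zx: "Z (t, 0) = t * a" and Zy: "Z (0, t) = t * b" if "0 \<le> t" for t
    using Zs[of t "(1, 0)"] Zs[of t "(0, 1)"] that by (auto simp: a_def b_def)
  have "Z p \<noteq> 0 \<and> 0 \<le> Z p" if "p \<noteq> 0" for p
    using Z that unfolding is_norm_def by blast
  from this[of "(1, 0)"] this[of "(0, 1)"] have pos: "a > 0" "b > 0"
    by (auto simp: a_def b_def zero_prod_def)
  have lx: "norm (fst p) * a \<le> ?N p" and ly: "norm (snd p) * b \<le> ?N p" for p
    using direct_sum_norm_mono[OF mono, of "norm (fst p)" "norm (fst p)" 0 "norm (snd p)"]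
      direct_sum_norm_mono[OF mono, of 0 "norm (fst p)" "norm (snd p)" "norm (snd p)"]
    by (auto simp: Zx Zy direct_sum_norm_def split_beta)
  have up: "?N p \<le> norm (fst p) * a + norm (snd p) * b" for p
  proof -
    have "Z ((norm (fst p), 0) + (0, norm (snd p))) \<le> Z (norm (fst p), 0) + Z (0, norm (snd p))"
      using Z unfolding is_norm_def by blast
    then show ?thesis by (simp add: Zx Zy direct_sum_norm_def split_beta)
  qed
  have "M.mcomplete"
    unfolding M.mcomplete_def
  proof (intro allI impI)
    fix s :: "nat \<Rightarrow> 'a \<times> 'b" assume s: "M.MCauchy s"
    have C: "\<exists>n0. \<forall>m\<ge>n0. \<forall>n\<ge>n0. ?N (s m - s n) < e" if "e > 0" for e
    proof -
      have "\<forall>e>0. \<exists>n0. \<forall>m n. n0 \<le> m \<longrightarrow> n0 \<le> n \<longrightarrow> ?N (s m - s n) < e"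
        using s unfolding M.MCauchy_def by (rule conjunct2)
      from this[rule_format, OF that] obtain n0
        where "\<forall>m n. n0 \<le> m \<longrightarrow> n0 \<le> n \<longrightarrow> ?N (s m - s n) < e" ..
      then show ?thesis by (intro exI[of _ n0]) simp
    qed
    have "Cauchy (\<lambda>n. fst (s n))"
    proof (rule metric_CauchyI)
      fix e :: real assume "e > 0"
      then obtain n0 where n0: "\<forall>m\<ge>n0. \<forall>n\<ge>n0. ?N (s m - s n) < e * a"
        using C[of "e * a"] pos by (meson mult_pos_pos)
      have "dist (fst (s m)) (fst (s n)) < e" if "m \<ge> n0" "n \<ge> n0" for m n
      proof -
        have "norm (fst (s m - s n)) * a < e * a"
          using lx[of "s m - s n"] n0[rule_format, OF that] by (rule le_less_trans)
        then show ?thesis using pos by (simp add: dist_norm)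
      qed
      then show "\<exists>M. \<forall>m\<ge>M. \<forall>n\<ge>M. dist (fst (s m)) (fst (s n)) < e" by blast
    qed
    then obtain x where x: "(\<lambda>n. fst (s n)) \<longlonglongrightarrow> x"
      using Cauchy_convergent convergent_def by blast
    have "Cauchy (\<lambda>n. snd (s n))"
    proof (rule metric_CauchyI)
      fix e :: real assume "e > 0"
      then obtain n0 where n0: "\<forall>m\<ge>n0. \<forall>n\<ge>n0. ?N (s m - s n) < e * b"
        using C[of "e * b"] pos by (meson mult_pos_pos)
      have "dist (snd (s m)) (snd (s n)) < e" if "m \<ge> n0" "n \<ge> n0" for m n
      proof -
        have "norm (snd (s m - s n)) * b < e * b"
          using ly[of "s m - s n"] n0[rule_format, OF that] by (rule le_less_trans)
        then show ?thesis using pos by (simp add: dist_norm)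
      qed
      then show "\<exists>M. \<forall>m\<ge>M. \<forall>n\<ge>M. dist (snd (s m)) (snd (s n)) < e" by blast
    qed
    then obtain y where y: "(\<lambda>n. snd (s n)) \<longlonglongrightarrow> y"
      using Cauchy_convergent convergent_def by blast
    have "(\<lambda>n. norm (fst (s n) - x) * a + norm (snd (s n) - y) * b)
            \<longlonglongrightarrow> norm (x - x) * a + norm (y - y) * b"
      by (intro tendsto_intros x y)
    then have lim0: "(\<lambda>n. norm (fst (s n) - x) * a + norm (snd (s n) - y) * b) \<longlonglongrightarrow> 0"
      by simp
    have "(\<lambda>n. ?N (s n - (x, y))) \<longlonglongrightarrow> 0"
    proof (rule tendsto_sandwich[OF _ _ tendsto_const lim0])
      show "\<forall>\<^sub>F n in sequentially. 0 \<le> ?N (s n - (x, y))"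
        using nN unfolding is_norm_def by (intro always_eventually allI) (elim conjE allE)
      show "\<forall>\<^sub>F n in sequentially.
              ?N (s n - (x, y)) \<le> norm (fst (s n) - x) * a + norm (snd (s n) - y) * b"
        proof (intro always_eventually allI)
        fix n
        show "?N (s n - (x, y)) \<le> norm (fst (s n) - x) * a + norm (snd (s n) - y) * b"
          using up[of "s n - (x, y)"] by (simp only: fst_diff snd_diff fst_conv snd_conv)
      qed
    qed
    then have "limitin M.mtopology s (x, y) sequentially"
      by (simp add: M.limitin_metric_dist_null)
    then show "\<exists>p. limitin M.mtopology s p sequentially" by blast
  qed
  with nN show ?thesis by (simp add: is_banach_norm_def)
qed

end

theory Submission
  imports Defs
begin

text \<open>
  Suppose that \<open>T\<close> maps a weakly compact convex set of \<open>X \<oplus>\<^sub>Z Y\<close> into itself without increasing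
  distances, and let \<open>K\<close> be a minimal nonempty closed convex invariant subset
  (\<open>minimal_invariant_exists\<close>).  The point of the proof is that \<open>K\<close> lies in a single slice
  \<open>X \<times> {y}\<close>.  Distances within a slice are a multiple of those in \<open>X\<close>, so the weak fixed point property
  of \<open>X\<close> finishes the proof.

  To find the slice, take points \<open>w n\<close> of \<open>K\<close> with \<open>T (w n) - w n\<close> tending to zero.  Since \<open>Y\<close> is
  finite-dimensional, their second components may be assumed to converge to some \<open>y\<close>.  By the
  Goebel--Karlovitz lemma (\<open>goebel_karlovitz_compact\<close>), the distances of \<open>w n\<close> from a given point of \<open>K\<close>
  tend to the diameter \<open>d\<close> of \<open>K\<close>.  If a point \<open>z\<close> satisfies \<open>N (z - x) \<le> t d\<close> and
  \<open>N (z - w) \<le> (1 - t) d\<close> while \<open>N (x - w)\<close> is about \<open>d\<close>, then \<open>z\<close> is metrically between \<open>x\<close> and \<open>w\<close>.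
  Strict monotonicity of \<open>Z\<close> passes this on to the second components
  (\<open>direct_sum_norm_monotone_metric\<close>, \<open>strictly_monotone_uniform\<close>), so that the second component of \<open>z\<close>
  is no farther from that of \<open>w\<close> than the second component of \<open>x\<close> is.

  Now let the sequence \<open>w\<close> generate a convex invariant set in stages, each of which joins points of the
  previous stage and their images by segments.  A further generator \<open>w m\<close> adds, at each stage, only
  points that are metrically between \<open>w m\<close> and a point generated without it (\<open>between_segments_pow\<close>),
  and by the preceding paragraph their second components stay close to \<open>y\<close> if those of the earlier points
  do.  A passage to the limit that keeps the number of stages fixed while initial segments of the
  sequence are discarded yields an invariant convex subset of \<open>K\<close> on which the second component
  equals \<open>y\<close>; by minimality it is dense in \<open>K\<close> (\<open>seminorm_vanishes_on_minimal_set\<close>).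

  Two consequences of weak compactness prepare the ground.  Closed convex sets are weakly closed by the
  Hahn--Banach theorem (\<open>separate_point_convex\<close>), so chains of them have nonempty intersections in a
  weakly compact set; and weakly compact sets are bounded by the uniform boundedness principle
  (\<open>weakly_bounded_imp_bounded\<close>).
\<close>

section \<open>Linear functionals on normed spaces\<close>

definition sublinear :: "('v::real_vector \<Rightarrow> real) \<Rightarrow> bool" where
  "sublinear p \<longleftrightarrow> (\<forall>x y. p (x + y) \<le> p x + p y) \<and> (\<forall>c\<ge>0. \<forall>x. p (c *\<^sub>R x) = c * p x)"

lemma sublinear_add: "sublinear p \<Longrightarrow> p (x + y) \<le> p x + p y"
  and sublinear_scale: "sublinear p \<Longrightarrow> 0 \<le> c \<Longrightarrow> p (c *\<^sub>R x) = c * p x"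
  by (auto simp: sublinear_def)

lemma sublinear_zero: "sublinear p \<Longrightarrow> p 0 = 0"
  using sublinear_scale[of p 0 0] by simp

lemma sublinear_ge_minus: "sublinear p \<Longrightarrow> - p (- x) \<le> p x"
  using sublinear_add[of p x "- x"] sublinear_zero[of p] by simp

lemma sublinear_chain_Inf:
  assumes "C \<noteq> {}" and "\<forall>q\<in>C. sublinear q \<and> q \<le> p"
    and chain: "\<forall>q\<in>C. \<forall>q'\<in>C. q \<le> q' \<or> q' \<le> q"
  shows "sublinear (\<lambda>x. INF q\<in>C. q x)" and "\<And>q. q \<in> C \<Longrightarrow> (\<lambda>x. INF q\<in>C. q x) \<le> q"
proof -
  have sub: "sublinear q" and below: "q \<le> p" if "q \<in> C" for q using assms(2) that by auto
  have lb: "- p (- x) \<le> q x" if "q \<in> C" for q x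
    using sublinear_ge_minus[OF sub[OF that], of x] le_funD[OF below[OF that], of "- x"] by linarith
  have bdd: "bdd_below ((\<lambda>q. q x) ` C)" for x
    by (rule bdd_belowI2[where m = "- p (- x)"]) (rule lb)
  have le: "(INF q\<in>C. q x) \<le> q x" if "q \<in> C" for q x
    by (rule cINF_lower[OF bdd that])
  then show "\<And>q. q \<in> C \<Longrightarrow> (\<lambda>x. INF q\<in>C. q x) \<le> q" by (simp add: le_fun_def)
  have add: "(INF q\<in>C. q (x + y)) \<le> (INF q\<in>C. q x) + (INF q\<in>C. q y)" for x y
  proof -
    have "(INF q\<in>C. q (x + y)) - q' y \<le> q x" if q: "q \<in> C" "q' \<in> C" for q q'
    proof -
      obtain r where r: "r \<in> C" "r \<le> q" "r \<le> q'" using chain q by blast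
      have "(INF q\<in>C. q (x + y)) \<le> r x + r y"
        using le[OF r(1), of "x + y"] sublinear_add[OF sub[OF r(1)], of x y] by linarith
      also have "\<dots> \<le> q x + q' y" using r by (intro add_mono) (auto simp: le_fun_def)
      finally show ?thesis by simp
    qed
    then have "(INF q\<in>C. q (x + y)) - q' y \<le> (INF q\<in>C. q x)" if "q' \<in> C" for q'
      using that assms(1) by (intro cINF_greatest) auto
    then have "(INF q\<in>C. q (x + y)) - (INF q\<in>C. q x) \<le> (INF q\<in>C. q y)"
      using assms(1) by (intro cINF_greatest) (auto simp: algebra_simps)
    then show ?thesis by simp
  qed
  have scale: "(INF q\<in>C. q (c *\<^sub>R x)) = c * (INF q\<in>C. q x)" if c: "0 \<le> c" for c x
  proof -
    have "(INF q\<in>C. q (c *\<^sub>R x)) = (INF q\<in>C. c * q x)"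
      using sub c by (intro INF_cong refl) (simp add: sublinear_scale)
    also have "\<dots> = c * (INF q\<in>C. q x)"
    proof (cases "c = 0")
      case True
      then show ?thesis using assms(1) by simp
    next
      case False
      then have c: "c > 0" using c by simp
      show ?thesis
      proof (rule antisym)
        have "(INF q\<in>C. c * q x) / c \<le> q x" if "q \<in> C" for q
        proof -
          have "c * (- p (- x)) \<le> c * q x" if "q \<in> C" for q
            by (rule mult_left_mono[OF lb[OF that]]) (use c in simp)
          then have "(INF q\<in>C. c * q x) \<le> c * q x"
            using that by (intro cINF_lower bdd_belowI2)
          then show ?thesis using c by (simp add: field_simps)
        qed
        then have "(INF q\<in>C. c * q x) / c \<le> (INF q\<in>C. q x)"
          using assms(1) by (intro cINF_greatest)
        then show "(INF q\<in>C. c * q x) \<le> c * (INF q\<in>C. q x)" using c by (simp add: field_simps)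
        show "c * (INF q\<in>C. q x) \<le> (INF q\<in>C. c * q x)"
          using assms(1) c le by (intro cINF_greatest) auto
      qed
    qed
    finally show ?thesis .
  qed
  show "sublinear (\<lambda>x. INF q\<in>C. q x)"
    unfolding sublinear_def using add scale by blast
qed

text \<open>
  This modification of \<open>q\<close> stays below \<open>q\<close> and is linear on the line through \<open>y\<close>: it takes the values
  \<open>q y\<close> at \<open>y\<close> and \<open>- q y\<close> at \<open>- y\<close>.
\<close>
lemma sublinear_directional:
  assumes q: "sublinear q"
  shows "sublinear (\<lambda>x. INF t\<in>{0..}. q (x + t *\<^sub>R y) - t * q y)" (is "sublinear ?r")
    and "0 \<le> t \<Longrightarrow> (INF t\<in>{0..}. q (x + t *\<^sub>R y) - t * q y) \<le> q (x + t *\<^sub>R y) - t * q y"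
proof -
  have lb: "- q (- x) \<le> q (x + t *\<^sub>R y) - t * q y" if "0 \<le> t" for t x
    using sublinear_add[OF q, of "x + t *\<^sub>R y" "- x"] sublinear_scale[OF q that, of y] by simp
  have bdd: "bdd_below ((\<lambda>t. q (x + t *\<^sub>R y) - t * q y) ` {0..})" for x
    by (rule bdd_belowI2[where m = "- q (- x)"]) (use lb in auto)
  have le: "?r x \<le> q (x + t *\<^sub>R y) - t * q y" if "0 \<le> t" for x t
    by (rule cINF_lower[OF bdd]) (use that in auto)
  then show "0 \<le> t \<Longrightarrow> ?r x \<le> q (x + t *\<^sub>R y) - t * q y" .
  have add: "?r (x + z) \<le> ?r x + ?r z" for x z
  proof -
    have "?r (x + z) - (q (z + s *\<^sub>R y) - s * q y) \<le> q (x + t *\<^sub>R y) - t * q y" if "0 \<le> t" "0 \<le> s" for t s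
      using le[of "t + s" "x + z"] sublinear_add[OF q, of "x + t *\<^sub>R y" "z + s *\<^sub>R y"] that
      by (simp add: algebra_simps)
    then have "?r (x + z) - (q (z + s *\<^sub>R y) - s * q y) \<le> ?r x" if "0 \<le> s" for s
      using that by (intro cINF_greatest) auto
    then have "?r (x + z) - ?r x \<le> ?r z"
      by (intro cINF_greatest) (auto simp: algebra_simps)
    then show ?thesis by simp
  qed
  have scale1: "c * ?r x \<le> ?r (c *\<^sub>R x)" if c: "0 < c" for c x
  proof (rule cINF_greatest)
    fix t :: real assume t: "t \<in> {0..}"
    have "c * ?r x \<le> c * (q (x + (t / c) *\<^sub>R y) - (t / c) * q y)"
      using c t le[of "t / c" x] by (intro mult_left_mono) auto
    also have "\<dots> = q (c *\<^sub>R (x + (t / c) *\<^sub>R y)) - t * q y"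
      using c by (simp add: sublinear_scale[OF q] right_diff_distrib)
    also have "\<dots> = q (c *\<^sub>R x + t *\<^sub>R y) - t * q y"
      using c by (simp add: scaleR_add_right)
    finally show "c * ?r x \<le> q (c *\<^sub>R x + t *\<^sub>R y) - t * q y" .
  qed auto
  have "?r (c *\<^sub>R x) = c * ?r x" if c: "0 \<le> c" for c x
  proof (cases "c = 0")
    case True
    have "?r 0 = (INF t\<in>{0..}::real set. 0)"
      by (intro INF_cong refl) (simp add: sublinear_scale[OF q])
    then show ?thesis using True by simp
  next
    case False
    then have c: "c > 0" using c by simp
    have "?r (c *\<^sub>R x) \<le> c * ?r x"
      using scale1[of "1 / c" "c *\<^sub>R x"] c by (simp add: field_simps)
    with scale1[OF c, of x] show ?thesis by (rule antisym[rotated])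
  qed
  with add show "sublinear ?r" unfolding sublinear_def by blast
qed

text \<open>
  The Hahn--Banach theorem.  By Zorn's lemma there is a minimal sublinear function below \<open>p\<close>.
  A minimal one equals its own modification in every direction \<open>y\<close>, and evaluating that
  modification at \<open>t = 1\<close> gives the inequality that subadditivity lacks.
\<close>
theorem linear_below_sublinear:
  assumes p: "sublinear p"
  shows "\<exists>f. linear f \<and> f \<le> p"
proof -
  define A where "A = {q. sublinear q \<and> q \<le> p}"
  have "\<exists>m\<in>A. \<forall>a\<in>A. (\<lambda>x y. y \<le> x) m a \<longrightarrow> a = m"
  proof (rule predicate_Zorn[of A "\<lambda>x y. y \<le> x"])
    show "partial_order_on A (relation_of (\<lambda>x y. y \<le> x) A)"
      by (rule partial_order_on_relation_ofI) auto
    fix C assume C: "C \<in> Chains (relation_of (\<lambda>x y. y \<le> x) A)"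
    show "\<exists>u\<in>A. \<forall>a\<in>C. u \<le> a"
    proof (cases "C = {}")
      case True
      then show ?thesis using p by (auto simp: A_def)
    next
      case False
      have CA: "\<forall>q\<in>C. sublinear q \<and> q \<le> p" and ch: "\<forall>q\<in>C. \<forall>q'\<in>C. q \<le> q' \<or> q' \<le> q"
        using C by (auto simp: Chains_def relation_of_def A_def)
      note le = sublinear_chain_Inf(2)[OF False CA ch]
      have "sublinear (\<lambda>x. INF q\<in>C. q x)" by (rule sublinear_chain_Inf(1)[OF False CA ch])
      moreover obtain q where "q \<in> C" using False by blast
      ultimately have "(\<lambda>x. INF q\<in>C. q x) \<in> A"
        using order_trans[OF le[OF \<open>q \<in> C\<close>], of p] CA by (simp add: A_def)
      with le show ?thesis by blast
    qed
  qed
  then obtain q where qA: "q \<in> A" and max: "\<forall>a\<in>A. a \<le> q \<longrightarrow> a = q" by blast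
  from qA have q: "sublinear q" "q \<le> p" by (simp_all add: A_def)
  have min: "r = q" if "sublinear r" "r \<le> q" for r
    using max that order_trans[OF that(2) q(2)] by (simp add: A_def)
  have add: "q (x + y) = q x + q y" for x y
  proof -
    let ?r = "\<lambda>x. INF t\<in>{0..}. q (x + t *\<^sub>R y) - t * q y"
    have "?r \<le> q" using sublinear_directional(2)[OF q(1), of 0 _ y] by (simp add: le_fun_def)
    with sublinear_directional(1)[OF q(1)] have "?r = q" by (rule min)
    then have "q x = ?r x" by (rule fun_cong[OF sym])
    also have "\<dots> \<le> q (x + y) - q y"
      using sublinear_directional(2)[OF q(1), of 1 x y] by simp
    finally show ?thesis using sublinear_add[OF q(1), of x y] by simp
  qed
  have "q (c *\<^sub>R x) = c * q x" for c x
  proof (cases "0 \<le> c")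
    case False
    have "q (c *\<^sub>R x) + q ((- c) *\<^sub>R x) = 0"
      using add[of "c *\<^sub>R x" "(- c) *\<^sub>R x"] sublinear_zero[OF q(1)] by simp
    then show ?thesis using False sublinear_scale[OF q(1), of "- c" x] by simp
  qed (rule sublinear_scale[OF q(1)])
  with add have "linear q" by (intro linearI) auto
  with q(2) show ?thesis by blast
qed

text \<open>
  Separation with a prescribed gap: a functional of norm at most one separates a point from a convex
  set by any lower bound \<open>\<delta>\<close> for their distance.  The sublinear function is the infimum of
  \<open>norm (z + t (k - x)) - t \<delta>\<close> over \<open>t \<ge> 0\<close> and \<open>k \<in> K\<close>; it lies below the norm (take \<open>t = 0\<close>), is
  finite because \<open>norm (k - x) \<ge> \<delta>\<close>, and is at most \<open>- \<delta>\<close> at \<open>x - k\<close> (take \<open>t = 1\<close>).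
\<close>
lemma separate_point_convex:
  fixes K :: "'v::real_normed_vector set"
  assumes K: "convex K" and \<delta>: "\<And>k. k \<in> K \<Longrightarrow> \<delta> \<le> norm (k - x)"
  shows "\<exists>f. bounded_linear f \<and> (\<forall>z. \<bar>f z\<bar> \<le> norm z) \<and> (\<forall>k\<in>K. f x + \<delta> \<le> f k)"
proof (cases "K = {}")
  case True
  then show ?thesis by (intro exI[of _ "\<lambda>z. 0"]) (auto intro: bounded_linear_zero)
next
  case False
  define P where "P = {0::real..} \<times> K"
  define g where "g = (\<lambda>z (t, k). norm (z + t *\<^sub>R (k - x)) - t * \<delta>)"
  define p where "p z = (INF c\<in>P. g z c)" for z
  have ne: "P \<noteq> {}" using False by (auto simp: P_def)
  have lb: "- norm z \<le> g z c" if cP: "c \<in> P" for z c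
  proof -
    obtain t k where c: "c = (t, k)" "0 \<le> t" "k \<in> K" using cP by (auto simp: P_def)
    have "t * \<delta> \<le> norm (t *\<^sub>R (k - x))" using c \<delta> by (auto intro: mult_left_mono)
    also have "\<dots> \<le> norm (z + t *\<^sub>R (k - x)) + norm z"
      using norm_triangle_ineq4[of "z + t *\<^sub>R (k - x)" z] by simp
    finally show ?thesis by (simp add: c g_def)
  qed
  have le: "p z \<le> g z c" if "c \<in> P" for z c
    unfolding p_def by (rule cINF_lower[OF bdd_belowI2[where m = "- norm z"] that]) (rule lb)
  have add: "p (z + z') \<le> p z + p z'" for z z'
  proof -
    have *: "p (z + z') \<le> g z c + g z' c'" if cc: "c \<in> P" "c' \<in> P" for c c'
    proof -
      obtain t k t' k' where c: "c = (t, k)" "0 \<le> t" "k \<in> K" "c' = (t', k')" "0 \<le> t'" "k' \<in> K"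
        using cc by (auto simp: P_def)
      \<comment> \<open>The cone generated by \<open>K - x\<close> is closed under addition.\<close>
      obtain k'' where k'': "k'' \<in> K" "(t + t') *\<^sub>R (k'' - x) = t *\<^sub>R (k - x) + t' *\<^sub>R (k' - x)"
      proof (cases "t + t' = 0")
        case True
        with c have "t = 0" "t' = 0" by auto
        with c that[of k] show ?thesis by simp
      next
        case False
        with c have pos: "t + t' > 0" by simp
        have "(t / (t + t')) *\<^sub>R k + (t' / (t + t')) *\<^sub>R k' \<in> K"
          using c pos by (intro convexD[OF K]) (auto simp: add_divide_distrib[symmetric])
        moreover have "(t + t') *\<^sub>R ((t / (t + t')) *\<^sub>R k + (t' / (t + t')) *\<^sub>R k' - x) = t *\<^sub>R (k - x) + t' *\<^sub>R (k' - x)"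
          using pos by (simp add: scaleR_add_right scaleR_diff_right scaleR_add_left)
        ultimately show ?thesis by (rule that)
      qed
      have "p (z + z') \<le> g (z + z') (t + t', k'')"
        using c k'' by (intro le) (auto simp: P_def)
      also have "\<dots> = norm ((z + t *\<^sub>R (k - x)) + (z' + t' *\<^sub>R (k' - x))) - (t + t') * \<delta>"
        unfolding g_def by (simp only: prod.case k''(2)) (simp only: add_ac)
      also have "\<dots> \<le> g z c + g z' c'"
        using norm_triangle_ineq[of "z + t *\<^sub>R (k - x)" "z' + t' *\<^sub>R (k' - x)"]
        by (simp add: g_def c algebra_simps)
      finally show ?thesis .
    qed
    have "p (z + z') - g z' c' \<le> p z" if "c' \<in> P" for c'
      unfolding p_def[of z] using * that ne by (intro cINF_greatest) (auto simp: algebra_simps)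
    then have "p (z + z') - p z \<le> p z'"
      unfolding p_def[of z'] using ne by (intro cINF_greatest) (auto simp: algebra_simps)
    then show ?thesis by simp
  qed
  have p_le_norm: "p z \<le> norm z" for z
  proof -
    obtain k where "k \<in> K" using False by blast
    then show ?thesis using le[of "(0, k)" z] by (simp add: P_def g_def)
  qed
  have scale1: "c * p z \<le> p (c *\<^sub>R z)" if c: "0 < c" for c z
    unfolding p_def[of "c *\<^sub>R z"]
  proof (rule cINF_greatest[OF ne])
    fix e assume "e \<in> P"
    then obtain t k where e: "e = (t, k)" "0 \<le> t" "k \<in> K" by (auto simp: P_def)
    have "c * p z \<le> c * g z (t / c, k)"
      using c e by (intro mult_left_mono le) (auto simp: P_def)
    also have "\<dots> = norm (c *\<^sub>R (z + (t / c) *\<^sub>R (k - x))) - t * \<delta>"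
      using c by (simp add: g_def right_diff_distrib)
    also have "\<dots> = g (c *\<^sub>R z) e"
      using c by (simp add: g_def e scaleR_add_right)
    finally show "c * p z \<le> g (c *\<^sub>R z) e" .
  qed
  have "p (c *\<^sub>R z) = c * p z" if c: "0 \<le> c" for c z
  proof (cases "c = 0")
    case True
    have "0 \<le> p 0" unfolding p_def using lb[of _ 0] ne by (intro cINF_greatest) auto
    then show ?thesis using True p_le_norm[of 0] by simp
  next
    case False
    then have c: "c > 0" using c by simp
    have "p (c *\<^sub>R z) \<le> c * p z"
      using scale1[of "1 / c" "c *\<^sub>R z"] c by (simp add: field_simps)
    with scale1[OF c, of z] show ?thesis by (rule antisym[rotated])
  qed
  with add have "sublinear p" unfolding sublinear_def by blast
  then obtain f where f: "linear f" "\<And>z. f z \<le> p z"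
    using linear_below_sublinear by (auto simp: le_fun_def)
  have abs: "\<bar>f z\<bar> \<le> norm z" for z
    using order_trans[OF f(2) p_le_norm, of z] order_trans[OF f(2) p_le_norm, of "- z"]
    by (simp add: linear_neg[OF f(1)] abs_le_iff)
  moreover have "bounded_linear f"
    using f(1) abs by (auto simp: bounded_linear_def bounded_linear_axioms_def intro!: exI[of _ 1])
  moreover have "f x + \<delta> \<le> f k" if "k \<in> K" for k
  proof -
    have "f (x - k) \<le> g (x - k) (1, k)"
      by (rule order_trans[OF f(2) le]) (simp add: P_def that)
    then show ?thesis by (simp add: g_def linear_diff[OF f(1)])
  qed
  ultimately show ?thesis by blast
qed

lemma norming_functional:
  fixes x :: "'v::real_normed_vector"
  shows "\<exists>f. bounded_linear f \<and> (\<forall>z. \<bar>f z\<bar> \<le> norm z) \<and> f x = norm x"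
proof -
  obtain f where f: "bounded_linear f" "\<And>z. \<bar>f z\<bar> \<le> norm z" "f 0 + norm x \<le> f x"
    using separate_point_convex[OF convex_singleton[of x], of "norm x" 0] by (simp add: Ball_def) blast
  then have "f x = norm x"
    using f(2)[of x] f(3) linear_0[OF bounded_linear.linear[OF f(1)]] by linarith
  with f show ?thesis by blast
qed

text \<open>
  The uniform boundedness principle for points of \<open>S\<close> acting on the dual space, which is complete even
  if the space is not.  Baire's theorem gives a ball of functionals on which all of \<open>S\<close> is bounded by
  the same number, and norming functionals turn this into a bound for the norms.
\<close>
lemma weakly_bounded_imp_bounded:
  fixes S :: "'v::real_normed_vector set"
  assumes wb: "\<And>f::'v \<Rightarrow> real. bounded_linear f \<Longrightarrow> bounded (f ` S)"
  shows "bounded S"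
proof -
  define F where "F n = {g :: 'v \<Rightarrow>\<^sub>L real. \<forall>x\<in>S. \<bar>blinfun_apply g x\<bar> \<le> real n}" for n
  have "\<exists>n. g \<in> F n" for g
  proof -
    have "bounded (blinfun_apply g ` S)"
      by (rule wb) (rule blinfun.bounded_linear_right)
    then obtain b where b: "\<forall>y\<in>blinfun_apply g ` S. norm y \<le> b" unfolding bounded_iff by blast
    obtain n where n: "b \<le> real n" using real_arch_simple by blast
    have "\<bar>blinfun_apply g x\<bar> \<le> real n" if "x \<in> S" for x
      using order_trans[OF bspec[OF b imageI[OF that]] n] by simp
    then show ?thesis unfolding F_def by blast
  qed
  then have "\<Union>(range F) = UNIV" by blast
  then have "euclidean interior_of \<Union>(range F) \<noteq> {}" by simp
  moreover have "closed (F n)" for n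
  proof -
    have "F n = (\<Inter>x\<in>S. {g. \<bar>blinfun_apply g x\<bar> \<le> real n})" by (auto simp: F_def)
    moreover have "closed {g :: 'v \<Rightarrow>\<^sub>L real. \<bar>blinfun_apply g x\<bar> \<le> real n}" for x
      by (intro closed_Collect_le continuous_intros)
    ultimately show ?thesis by (simp add: closed_INT)
  qed
  ultimately have "\<not> (\<forall>T\<in>range F. euclidean interior_of T = {})"
    using Baire_category_alt[OF disjI1[OF completely_metrizable_space_euclidean], of "range F"]
    by auto
  then obtain n g0 where "g0 \<in> interior (F n)" by auto
  then obtain r where r: "r > 0" "ball g0 r \<subseteq> F n" unfolding mem_interior by blast
  have "norm x \<le> 2 * (2 * real n / r)" if x: "x \<in> S" for x
  proof -
    obtain f where f: "bounded_linear f" "\<And>z. \<bar>f z\<bar> \<le> norm z" "f x = norm x"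
      using norming_functional by blast
    define h where "h = Blinfun f"
    have h: "blinfun_apply h = f" using f(1) by (simp add: h_def bounded_linear_Blinfun_apply)
    have "norm h \<le> 1" by (rule norm_blinfun_bound) (auto simp: h f)
    then have "r / 2 * norm h \<le> r / 2 * 1" using r by (intro mult_left_mono) auto
    then have "g0 + (r / 2) *\<^sub>R h \<in> ball g0 r" using r by (simp add: dist_norm)
    then have "\<bar>blinfun_apply g0 x + r / 2 * norm x\<bar> \<le> real n" and "\<bar>blinfun_apply g0 x\<bar> \<le> real n"
      using r x subsetD[OF r(2), of g0] subsetD[OF r(2), of "g0 + (r / 2) *\<^sub>R h"]
      by (auto simp: F_def blinfun.add_left blinfun.scaleR_left h f)
    then have "r / 2 * norm x \<le> 2 * real n" by linarith
    then show ?thesis using r by (simp add: field_simps)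
  qed
  then show ?thesis unfolding bounded_iff by blast
qed

section \<open>Weak compactness and minimal invariant sets\<close>

lemma continuous_on_is_norm:
  fixes N :: "'v::real_normed_vector \<Rightarrow> real"
  assumes N: "is_norm N" and upper: "\<And>x. N x \<le> b * norm x" and f: "continuous_on S f"
  shows "continuous_on S (\<lambda>x. N (f x))"
proof -
  have triangle: "N (x + y) \<le> N x + N y" for x y using N unfolding is_norm_def by blast
  have minus: "N (- x) = N x" for x
  proof -
    have "N ((- 1) *\<^sub>R x) = \<bar>- 1\<bar> * N x" using N unfolding is_norm_def by blast
    then show ?thesis by simp
  qed
  have "\<bar>N x - N y\<bar> \<le> \<bar>b\<bar> * norm (x - y)" for x y
  proof -
    have "\<bar>N x - N y\<bar> \<le> N (x - y)"
      using triangle[of "x - y" y] triangle[of "y - x" x] minus[of "x - y"] by simp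
    also have "\<dots> \<le> b * norm (x - y)" by (rule upper)
    also have "\<dots> \<le> \<bar>b\<bar> * norm (x - y)" by (intro mult_right_mono) auto
    finally show ?thesis .
  qed
  then have "lipschitz_on \<bar>b\<bar> UNIV N" by (intro lipschitz_onI) (auto simp: dist_norm)
  then have "continuous_on UNIV N" by (rule lipschitz_on_continuous_on)
  from continuous_on_compose2[OF this f] show ?thesis by simp
qed

text \<open>
  The norm of a direct sum is equivalent to the one that the product type carries.  Closed, compact,
  bounded and continuous therefore mean the same for both norms, and the library notions of the type
  class can be used for them; only inequalities between distances need \<open>N\<close> itself.
\<close>
locale equivalent_norm =
  fixes N :: "'v::real_normed_vector \<Rightarrow> real" and c b :: real
  assumes N: "is_norm N" and c: "0 < c"
    and lower: "c * norm x \<le> N x" and upper: "N x \<le> b * norm x"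
begin

lemma N_nonneg: "0 \<le> N x" and N_add: "N (x + y) \<le> N x + N y" and N_scale: "N (r *\<^sub>R x) = \<bar>r\<bar> * N x"
  and N_zero [simp]: "N 0 = 0"
  using N unfolding is_norm_def by auto

lemma N_minus: "N (- x) = N x"
  using N_scale[of "- 1" x] by simp

lemma N_commute: "N (x - y) = N (y - x)"
  using N_minus[of "x - y"] by simp

lemma N_triangle: "N (x - z) \<le> N (x - y) + N (y - z)"
  using N_add[of "x - y" "y - z"] by simp

lemma N_convex: "0 \<le> t \<Longrightarrow> t \<le> 1 \<Longrightarrow>
    N (((1 - t) *\<^sub>R x + t *\<^sub>R y) - ((1 - t) *\<^sub>R x' + t *\<^sub>R y')) \<le> (1 - t) * N (x - x') + t * N (y - y')"
proof -
  assume t: "0 \<le> t" "t \<le> 1"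
  have "((1 - t) *\<^sub>R x + t *\<^sub>R y) - ((1 - t) *\<^sub>R x' + t *\<^sub>R y') = (1 - t) *\<^sub>R (x - x') + t *\<^sub>R (y - y')"
    by (simp add: algebra_simps)
  then show ?thesis
    using N_add[of "(1 - t) *\<^sub>R (x - x')" "t *\<^sub>R (y - y')"] t by (simp add: N_scale)
qed

lemma continuous_on_N [continuous_intros]:
  "continuous_on S f \<Longrightarrow> continuous_on S (\<lambda>x. N (f x))"
  using continuous_on_is_norm[OF N upper] .

lemma closed_N_ball: "closed {x. N (x - y) \<le> r}"
  by (intro closed_Collect_le continuous_intros)

lemma convex_N_ball: "convex {x. N (x - y) \<le> r}"
proof (rule convexI)
  fix x x' and u v :: real
  assume *: "x \<in> {x. N (x - y) \<le> r}" "x' \<in> {x. N (x - y) \<le> r}" "0 \<le> u" "0 \<le> v" "u + v = 1"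
  then have u: "u = 1 - v" by simp
  have "N ((u *\<^sub>R x + v *\<^sub>R x') - y) \<le> (1 - v) * N (x - y) + v * N (x' - y)"
    using N_convex[of v x x' y y] * by (simp add: u algebra_simps)
  also have "\<dots> \<le> (1 - v) * r + v * r" using * by (intro add_mono mult_left_mono) auto
  finally show "u *\<^sub>R x + v *\<^sub>R x' \<in> {x. N (x - y) \<le> r}" by (simp add: algebra_simps)
qed

lemma bounded_linear_in_dual:
  fixes f :: "'v \<Rightarrow> real"
  assumes "bounded_linear f"
  shows "f \<in> dual_space N"
proof -
  obtain K where K: "K > 0" "\<And>x. norm (f x) \<le> norm x * K" using bounded_linear.pos_bounded[OF assms] by auto
  have "\<bar>f x\<bar> \<le> (K / c) * N x" for x
  proof -
    have "\<bar>f x\<bar> \<le> norm x * K" using K(2)[of x] by simp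
    also have "\<dots> \<le> (N x / c) * K" using K lower[of x] c by (intro mult_right_mono) (auto simp: field_simps)
    finally show ?thesis by (simp add: mult.commute)
  qed
  then have "\<exists>K. \<forall>x. \<bar>f x\<bar> \<le> K * N x" by (intro exI[of _ "K / c"] allI)
  then show ?thesis unfolding dual_space_def using bounded_linear.linear[OF assms] by simp
qed

lemma weakly_open_vimage:
  fixes f :: "'v \<Rightarrow> real"
  assumes "bounded_linear f" and "open U"
  shows "openin (weak_topology N) (f -` U)"
  unfolding weak_topology_def
  by (intro topology_generated_by_Basis CollectI exI[of _ f] exI[of _ U] conjI refl
      bounded_linear_in_dual assms)

lemma closed_convex_imp_weakly_closed:
  assumes K: "closed K" "convex K"
  shows "closedin (weak_topology N) K"
proof -
  have "\<exists>U. openin (weak_topology N) U \<and> x \<in> U \<and> U \<subseteq> - K" if "x \<notin> K" for x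
  proof -
    have "open (- K)" "x \<in> - K" using K that by auto
    then obtain \<delta> where \<delta>: "\<delta> > 0" "ball x \<delta> \<subseteq> - K" by (meson open_contains_ball)
    have "\<delta> \<le> norm (k - x)" if "k \<in> K" for k
    proof -
      have "k \<notin> ball x \<delta>" using \<delta>(2) that by blast
      then show ?thesis by (simp add: dist_norm norm_minus_commute)
    qed
    then obtain f where f: "bounded_linear f" "\<forall>k\<in>K. f x + \<delta> \<le> f k"
      using separate_point_convex[OF K(2), of \<delta> x] by blast
    have "x \<in> f -` {..<f x + \<delta>}" "f -` {..<f x + \<delta>} \<subseteq> - K" using f(2) \<delta>(1) by auto
    with weakly_open_vimage[OF f(1) open_lessThan] show ?thesis by blast
  qed
  then have "openin (weak_topology N) (- K)"
    by (subst openin_subopen) auto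
  then show ?thesis by (simp add: closedin_def N Compl_eq_Diff_UNIV)
qed

lemma weakly_compact_fip:
  assumes C: "compactin (weak_topology N) C"
    and F: "\<And>K. K \<in> F \<Longrightarrow> closed K \<and> convex K"
    and fip: "\<And>G. finite G \<Longrightarrow> G \<subseteq> F \<Longrightarrow> C \<inter> \<Inter>G \<noteq> {}"
  shows "C \<inter> \<Inter>F \<noteq> {}"
proof -
  have "\<forall>\<U>. (\<forall>K\<in>\<U>. closedin (weak_topology N) K) \<and> (\<forall>G. finite G \<and> G \<subseteq> \<U> \<longrightarrow> C \<inter> \<Inter>G \<noteq> {}) \<longrightarrow> C \<inter> \<Inter>\<U> \<noteq> {}"
    using C unfolding compactin_fip by (rule conjunct2)
  then have "(\<forall>K\<in>F. closedin (weak_topology N) K) \<and> (\<forall>G. finite G \<and> G \<subseteq> F \<longrightarrow> C \<inter> \<Inter>G \<noteq> {}) \<longrightarrow> C \<inter> \<Inter>F \<noteq> {}"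
    by (rule spec)
  moreover have "\<forall>K\<in>F. closedin (weak_topology N) K" using closed_convex_imp_weakly_closed F by simp
  moreover have "\<forall>G. finite G \<and> G \<subseteq> F \<longrightarrow> C \<inter> \<Inter>G \<noteq> {}" using fip by simp
  ultimately show ?thesis by simp
qed

text \<open>
  The form of weak compactness that provides minimal sets, as intersections of chains of invariant
  sets, and cluster points, as intersections of the closed convex hulls of the tails of a sequence.
\<close>
lemma weakly_compact_fip_chain:
  assumes C: "compactin (weak_topology N) C" and ne: "F \<noteq> {}"
    and F: "\<And>K. K \<in> F \<Longrightarrow> closed K \<and> convex K \<and> C \<inter> K \<noteq> {}"
    and chain: "\<And>K L. K \<in> F \<Longrightarrow> L \<in> F \<Longrightarrow> K \<subseteq> L \<or> L \<subseteq> K"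
  shows "C \<inter> \<Inter>F \<noteq> {}"
proof (rule weakly_compact_fip[OF C])
  show "\<And>K. K \<in> F \<Longrightarrow> closed K \<and> convex K" using F by blast
  fix G assume G: "finite G" "G \<subseteq> F"
  show "C \<inter> \<Inter>G \<noteq> {}"
  proof (cases "G = {}")
    case True
    then show ?thesis using ne F by auto
  next
    case False
    have "\<Inter>G \<in> G" using G(1) False G(2)
    proof (induction G rule: finite_ne_induct)
      case (insert K G)
      then have "\<Inter>G \<in> G" by blast
      with insert.prems chain[of K "\<Inter>G"] have "K \<subseteq> \<Inter>G \<or> \<Inter>G \<subseteq> K" by blast
      with \<open>\<Inter>G \<in> G\<close> show ?case by (auto simp: Int_absorb1 Int_absorb2)
    qed simp
    then show ?thesis using G F by blast
  qed
qed


text \<open>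
  Closed balls around a limit point of \<open>C\<close> all meet \<open>C\<close>, hence so does their intersection.
\<close>
lemma weakly_compact_imp_closed:
  assumes C: "compactin (weak_topology N) C"
  shows "closed C"
proof -
  have "x \<in> C" if x: "x \<in> closure C" for x
  proof -
    have "C \<inter> \<Inter>((\<lambda>r. cball x r) ` {0<..}) \<noteq> {}"
    proof (rule weakly_compact_fip_chain[OF C])
      fix K assume "K \<in> (\<lambda>r. cball x r) ` {0<..}"
      then obtain r where r: "r > 0" "K = cball x r" by auto
      obtain y where "y \<in> C" "dist y x < r" using x r(1) by (meson closure_approachable)
      then have "y \<in> C \<inter> K" using r by (simp add: dist_commute)
      with r show "closed K \<and> convex K \<and> C \<inter> K \<noteq> {}" by auto
    next
      fix K L assume "K \<in> (\<lambda>r. cball x r) ` {0<..}" "L \<in> (\<lambda>r. cball x r) ` {0<..}"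
      then obtain r s where "K = cball x r" "L = cball x s" by auto
      then show "K \<subseteq> L \<or> L \<subseteq> K"
        using subset_cball[of r s x] subset_cball[of s r x] by (metis linear)
    qed auto
    then obtain y where y: "y \<in> C" "\<forall>r\<in>{0<..}. dist x y \<le> r" by auto
    have "dist x y \<le> 0" by (rule field_le_epsilon) (use y(2) in simp)
    with y(1) show ?thesis by simp
  qed
  then show ?thesis using closure_subset_eq by blast
qed

lemma weakly_compact_imp_bounded:
  assumes C: "compactin (weak_topology N) C"
  shows "bounded C"
proof (rule weakly_bounded_imp_bounded)
  fix f :: "'v \<Rightarrow> real" assume f: "bounded_linear f"
  have "continuous_map (weak_topology N) euclideanreal f"
    unfolding continuous_map_def using weakly_open_vimage[OF f] by (simp add: N vimage_def)
  then have "compact (f ` C)"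
    using image_compactin[OF C, of euclideanreal f] by simp
  then show "bounded (f ` C)" by (rule compact_imp_bounded)
qed

definition minimal_invariant :: "('v \<Rightarrow> 'v) \<Rightarrow> 'v set \<Rightarrow> bool" where
  "minimal_invariant T K \<longleftrightarrow> K \<noteq> {} \<and> closed K \<and> convex K \<and> T \<in> K \<rightarrow> K \<and>
     (\<forall>L\<subseteq>K. L \<noteq> {} \<and> closed L \<and> convex L \<and> T \<in> L \<rightarrow> L \<longrightarrow> L = K)"

lemma minimal_invariant_exists:
  assumes C: "compactin (weak_topology N) C" "convex C" "C \<noteq> {}" and T: "T \<in> C \<rightarrow> C"
  shows "\<exists>K\<subseteq>C. minimal_invariant T K"
proof -
  define A where "A = {K. K \<subseteq> C \<and> K \<noteq> {} \<and> closed K \<and> convex K \<and> T \<in> K \<rightarrow> K}"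
  have "\<exists>m\<in>A. \<forall>a\<in>A. (\<lambda>K L. L \<subseteq> K) m a \<longrightarrow> a = m"
  proof (rule predicate_Zorn[of A "\<lambda>K L. L \<subseteq> K"])
    show "partial_order_on A (relation_of (\<lambda>K L. L \<subseteq> K) A)"
      by (rule partial_order_on_relation_ofI) auto
    fix F assume F: "F \<in> Chains (relation_of (\<lambda>K L. L \<subseteq> K) A)"
    then have FA: "F \<subseteq> A" and chain: "\<And>K L. K \<in> F \<Longrightarrow> L \<in> F \<Longrightarrow> K \<subseteq> L \<or> L \<subseteq> K"
      by (auto simp: Chains_def relation_of_def)
    show "\<exists>u\<in>A. \<forall>a\<in>F. u \<subseteq> a"
    proof (cases "F = {}")
      case True
      then show ?thesis using C T weakly_compact_imp_closed[OF C(1)] by (auto simp: A_def)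
    next
      case False
      have "C \<inter> \<Inter>F \<noteq> {}"
        using FA by (intro weakly_compact_fip_chain[OF C(1) False _ chain]) (auto simp: A_def)
      moreover have "C \<inter> \<Inter>F = \<Inter>F" using FA False by (auto simp: A_def)
      ultimately have "\<Inter>F \<in> A"
        using FA False unfolding A_def by (auto 0 3 intro!: closed_Inter convex_Inter)
      then show ?thesis by (intro bexI[of _ "\<Inter>F"]) auto
    qed
  qed
  then obtain K where K: "K \<in> A" "\<forall>L\<in>A. L \<subseteq> K \<longrightarrow> L = K" by blast
  have K': "K \<subseteq> C" "K \<noteq> {}" "closed K" "convex K" "T \<in> K \<rightarrow> K" using K(1) by (simp_all add: A_def)
  have "L = K" if "L \<subseteq> K" "L \<noteq> {} \<and> closed L \<and> convex L \<and> T \<in> L \<rightarrow> L" for L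
    using K(2) that order_trans[OF that(1) K'(1)] by (simp add: A_def)
  with K' have "minimal_invariant T K" by (simp add: minimal_invariant_def)
  with K'(1) show ?thesis by blast
qed

text \<open>
  Such a point has the role of the weak limit of a subsequence: a closed ball that contains a tail
  of \<open>w\<close> also contains \<open>x\<close>.
\<close>
lemma weak_cluster_point:
  assumes C: "compactin (weak_topology N) C" and w: "\<And>n::nat. w n \<in> C"
  shows "\<exists>x\<in>C. \<forall>n. x \<in> closure (convex hull (w ` {n..}))"
proof -
  have "C \<inter> \<Inter>(range (\<lambda>n. closure (convex hull (w ` {n..})))) \<noteq> {}"
  proof (rule weakly_compact_fip_chain[OF C])
    fix K assume "K \<in> range (\<lambda>n. closure (convex hull (w ` {n..})))"
    then obtain n where K: "K = closure (convex hull (w ` {n..}))" by auto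
    have "w n \<in> K" unfolding K by (intro subsetD[OF closure_subset] hull_inc) auto
    with w[of n] show "closed K \<and> convex K \<and> C \<inter> K \<noteq> {}"
      unfolding K by (auto intro: convex_closure)
  next
    fix K L assume "K \<in> range (\<lambda>n. closure (convex hull (w ` {n..})))" "L \<in> range (\<lambda>n. closure (convex hull (w ` {n..})))"
    then obtain m n where KL: "K = closure (convex hull (w ` {m..}))" "L = closure (convex hull (w ` {n..}))" by auto
    have "closure (convex hull (w ` {j..})) \<subseteq> closure (convex hull (w ` {i..}))" if "i \<le> j" for i j
      using that by (intro closure_mono hull_mono image_mono) auto
    then show "K \<subseteq> L \<or> L \<subseteq> K" unfolding KL using linear[of m n] by blast
  qed auto
  then show ?thesis by auto
qed

end

section \<open>Approximate fixed points in a minimal invariant set\<close>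

context equivalent_norm begin

lemma closure_N_approachable: "x \<in> closure S \<longleftrightarrow> (\<forall>e>0. \<exists>y\<in>S. N (y - x) < e)"
proof
  assume x: "x \<in> closure S"
  show "\<forall>e>0. \<exists>y\<in>S. N (y - x) < e"
  proof (intro allI impI)
    fix e :: real assume e: "e > 0"
    then obtain y where y: "y \<in> S" "dist y x < e / (\<bar>b\<bar> + 1)"
      using x by (meson closure_approachable divide_pos_pos abs_ge_zero add_nonneg_pos zero_less_one)
    have "N (y - x) \<le> b * norm (y - x)" by (rule upper)
    also have "\<dots> \<le> (\<bar>b\<bar> + 1) * norm (y - x)" by (intro mult_right_mono) auto
    also have "\<dots> < e" using y(2) by (simp add: dist_norm field_simps)
    finally show "\<exists>y\<in>S. N (y - x) < e" using y(1) by blast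
  qed
next
  assume *: "\<forall>e>0. \<exists>y\<in>S. N (y - x) < e"
  show "x \<in> closure S"
    unfolding closure_approachable
  proof (intro allI impI)
    fix e :: real assume e: "e > 0"
    then obtain y where y: "y \<in> S" "N (y - x) < c * e" using * c by (meson mult_pos_pos)
    have "c * norm (y - x) < c * e" using lower[of "y - x"] y(2) by linarith
    then have "dist y x < e" using c by (simp add: dist_norm)
    with y(1) show "\<exists>y\<in>S. dist y x < e" by blast
  qed
qed

end

locale minimal_nonexpansive = equivalent_norm N c b
  for N :: "'v::real_normed_vector \<Rightarrow> real" and c b +
  fixes T :: "'v \<Rightarrow> 'v" and K :: "'v set"
  assumes nonexpansive: "nonexpansive_on N K T"
    and minimal: "minimal_invariant T K"
    and weakly_compact: "compactin (weak_topology N) K"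
begin

lemma nonempty: "K \<noteq> {}" and closed_K: "closed K" and convex_K: "convex K"
  using minimal by (auto simp: minimal_invariant_def)

lemma T_in: "x \<in> K \<Longrightarrow> T x \<in> K"
  using minimal by (auto simp: minimal_invariant_def)

lemma T_nonexpansive: "x \<in> K \<Longrightarrow> y \<in> K \<Longrightarrow> N (T x - T y) \<le> N (x - y)"
  using nonexpansive by (simp add: nonexpansive_on_def)

lemma convex_K_D: "x \<in> K \<Longrightarrow> y \<in> K \<Longrightarrow> 0 \<le> t \<Longrightarrow> t \<le> 1 \<Longrightarrow> (1 - t) *\<^sub>R x + t *\<^sub>R y \<in> K"
  by (rule convexD[OF convex_K]) auto

lemma continuous_on_T: "continuous_on K T"
proof (rule continuous_on_iff[THEN iffD2], intro ballI allI impI)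
  fix x and e :: real assume x: "x \<in> K" and e: "e > 0"
  have "dist (T y) (T x) < e" if y: "y \<in> K" "dist y x < c * e / (\<bar>b\<bar> + 1)" for y
  proof -
    have "c * norm (T y - T x) \<le> N (T y - T x)" by (rule lower)
    also have "\<dots> \<le> N (y - x)" using T_nonexpansive x y by blast
    also have "\<dots> \<le> b * norm (y - x)" by (rule upper)
    also have "\<dots> \<le> (\<bar>b\<bar> + 1) * norm (y - x)" by (intro mult_right_mono) auto
    also have "\<dots> < c * e" using y(2) by (simp add: dist_norm field_simps)
    finally show ?thesis using c by (simp add: dist_norm)
  qed
  moreover have "0 < c * e / (\<bar>b\<bar> + 1)" using c e by (intro divide_pos_pos) auto
  ultimately show "\<exists>d>0. \<forall>x'\<in>K. dist x' x < d \<longrightarrow> dist (T x') (T x) < e" by blast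
qed

lemma minimal_eq:
  assumes "L \<subseteq> K" "L \<noteq> {}" "closed L" "convex L" "\<And>x. x \<in> L \<Longrightarrow> T x \<in> L"
  shows "L = K"
  using minimal assms unfolding minimal_invariant_def by (simp add: Pi_iff)

definition diam :: real where
  "diam = (SUP p\<in>K \<times> K. N (fst p - snd p))"

lemma diam_bdd: "bdd_above ((\<lambda>p. N (fst p - snd p)) ` (K \<times> K))"
proof -
  obtain B where B: "\<forall>x\<in>K. norm x \<le> B"
    using weakly_compact_imp_bounded[OF weakly_compact] unfolding bounded_iff by blast
  have "N (x - y) \<le> \<bar>b\<bar> * (B + B)" if "x \<in> K" "y \<in> K" for x y
  proof -
    have "N (x - y) \<le> b * norm (x - y)" by (rule upper)
    also have "\<dots> \<le> \<bar>b\<bar> * norm (x - y)" by (intro mult_right_mono) auto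
    also have "\<dots> \<le> \<bar>b\<bar> * (B + B)"
      using norm_triangle_ineq4[of x y] bspec[OF B that(1)] bspec[OF B that(2)]
      by (intro mult_left_mono) auto
    finally show ?thesis .
  qed
  then show ?thesis by (intro bdd_aboveI2[where M = "\<bar>b\<bar> * (B + B)"]) auto
qed

lemma diam_upper: "x \<in> K \<Longrightarrow> y \<in> K \<Longrightarrow> N (x - y) \<le> diam"
  unfolding diam_def using cSUP_upper[OF _ diam_bdd, of "(x, y)"] by simp

lemma diam_least: "(\<And>x y. x \<in> K \<Longrightarrow> y \<in> K \<Longrightarrow> N (x - y) \<le> r) \<Longrightarrow> diam \<le> r"
  unfolding diam_def using nonempty by (intro cSUP_least) auto

lemma diam_nonneg: "0 \<le> diam"
  using nonempty diam_upper N_nonneg by (meson ex_in_conv order_trans)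

text \<open>
  The contractions \<open>(1 - t) T + t p\<close> are uniformly close to \<open>T\<close> for small \<open>t\<close>, and the steps of their
  iterates tend to zero.
\<close>
lemma approximate_fixed_point:
  assumes \<delta>: "0 < \<delta>"
  shows "\<exists>w\<in>K. N (T w - w) < \<delta>"
proof -
  obtain p where p: "p \<in> K" using nonempty by blast
  define t where "t = min (1 / 2) (\<delta> / (2 * (diam + 1)))"
  have t: "0 < t" "t < 1" using \<delta> diam_nonneg by (auto simp: t_def)
  have "t * diam \<le> \<delta> / (2 * (diam + 1)) * diam" using diam_nonneg by (intro mult_right_mono) (auto simp: t_def)
  also have "\<dots> < \<delta> / 2" using \<delta> diam_nonneg by (simp add: field_simps)
  finally have td: "t * diam < \<delta> / 2" .
  define S where "S x = (1 - t) *\<^sub>R T x + t *\<^sub>R p" for x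
  have S_in: "S x \<in> K" if "x \<in> K" for x
    unfolding S_def using that p t T_in by (intro convex_K_D) auto
  have S_contr: "N (S x - S y) \<le> (1 - t) * N (x - y)" if "x \<in> K" "y \<in> K" for x y
  proof -
    have "N (S x - S y) = (1 - t) * N (T x - T y)"
      using t N_scale[of "1 - t" "T x - T y"] by (simp add: S_def scaleR_diff_right)
    also have "\<dots> \<le> (1 - t) * N (x - y)" using t T_nonexpansive that by (intro mult_left_mono) auto
    finally show ?thesis .
  qed
  have it_in: "(S ^^ k) p \<in> K" for k by (induction k) (auto simp: p S_in)
  have it: "N (S ((S ^^ k) p) - (S ^^ k) p) \<le> (1 - t) ^ k * diam" for k
  proof (induction k)
    case 0
    then show ?case using diam_upper S_in p by simp
  next
    case (Suc k)
    have "N (S ((S ^^ Suc k) p) - (S ^^ Suc k) p) \<le> (1 - t) * N (S ((S ^^ k) p) - (S ^^ k) p)"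
      using S_contr[OF S_in[OF it_in] it_in, of k k] by simp
    also have "\<dots> \<le> (1 - t) * ((1 - t) ^ k * diam)" using Suc t by (intro mult_left_mono) auto
    finally show ?case by simp
  qed
  have "(\<lambda>k. (1 - t) ^ k * diam) \<longlonglongrightarrow> 0 * diam"
    using t by (intro tendsto_mult LIMSEQ_power_zero tendsto_const) auto
  then have "\<forall>\<^sub>F k in sequentially. (1 - t) ^ k * diam < \<delta> / 2"
    using \<delta> by (intro order_tendstoD) auto
  then obtain k where k: "(1 - t) ^ k * diam < \<delta> / 2" by (meson eventually_sequentially order_refl)
  define z where "z = (S ^^ k) p"
  have z: "z \<in> K" "N (S z - z) < \<delta> / 2" using it[of k] k it_in unfolding z_def by auto
  have "T z - S z = t *\<^sub>R (T z - p)" by (simp add: S_def algebra_simps)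
  then have "N (T z - S z) = t * N (T z - p)" using t by (simp add: N_scale)
  also have "\<dots> \<le> t * diam" using t z(1) p T_in diam_upper by (intro mult_left_mono) auto
  finally have "N (T z - S z) < \<delta> / 2" using td by simp
  then have "N (T z - z) < \<delta>" using N_triangle[of "T z" z "S z"] z(2) by linarith
  with z(1) show ?thesis by blast
qed

text \<open>
  A minimal set has only diametral points: the points of \<open>K\<close> whose \<open>N\<close>-ball of radius \<open>r\<close> covers
  \<open>K\<close> form a closed convex invariant set, so if there is one then all points are such.
\<close>
lemma diametral_point:
  assumes x: "x \<in> K" and r: "\<And>y. y \<in> K \<Longrightarrow> N (y - x) \<le> r"
  shows "diam \<le> r"
proof -
  define L where "L = {x \<in> K. \<forall>y\<in>K. N (y - x) \<le> r}"
  have Leq: "L = K \<inter> (\<Inter>y\<in>K. {x. N (x - y) \<le> r})"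
    by (auto simp: L_def N_commute)
  have "L = K"
  proof (rule minimal_eq)
    show "L \<subseteq> K" by (auto simp: L_def)
    show "L \<noteq> {}" using x r by (auto simp: L_def)
    show "closed L" unfolding Leq by (intro closed_Int closed_K closed_INT ballI closed_N_ball)
    show "convex L" unfolding Leq by (intro convex_Int convex_K convex_INT convex_N_ball)
    fix x assume "x \<in> L"
    then have xK: "x \<in> K" and xr: "\<And>y. y \<in> K \<Longrightarrow> N (y - x) \<le> r" by (auto simp: L_def)
    \<comment> \<open>By minimality, \<open>K\<close> is the closed convex hull of its image.\<close>
    define M where "M = K \<inter> {y. N (y - T x) \<le> r}"
    have TM: "T y \<in> M" if "y \<in> K" for y
      using that T_in T_nonexpansive[OF that xK] xr[OF that] by (simp add: M_def)
    have "M = K"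
    proof (rule minimal_eq)
      show "M \<subseteq> K" by (simp add: M_def)
      then show "\<And>y. y \<in> M \<Longrightarrow> T y \<in> M" using TM by blast
      show "M \<noteq> {}" using TM xK by blast
      show "closed M" unfolding M_def by (intro closed_Int closed_K closed_N_ball)
      show "convex M" unfolding M_def by (intro convex_Int convex_K convex_N_ball)
    qed
    then have "N (y - T x) \<le> r" if "y \<in> K" for y using that by (auto simp: M_def)
    then show "T x \<in> L" using T_in xK by (simp add: L_def)
  qed
  then show ?thesis by (intro diam_least) (auto simp: L_def)
qed

text \<open>
  The asymptotic radius of an approximate fixed point sequence with respect to a point of \<open>K\<close> does not
  increase when that point is moved by \<open>T\<close>.  By minimality it is at most \<open>r\<close> at every point of \<open>K\<close>, so
  a weak cluster point of the sequence is within \<open>r\<close> of all of \<open>K\<close>.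
\<close>
lemma asymptotic_radius_ge_diam:
  assumes w: "\<And>n. w n \<in> K" and afp: "(\<lambda>n. N (T (w n) - w n)) \<longlonglongrightarrow> 0"
    and z: "z \<in> K" and r: "\<And>n. N (w n - z) \<le> r"
  shows "diam \<le> r"
proof -
  define M where "M = {x \<in> K. \<forall>e>0. \<forall>\<^sub>F n in sequentially. N (w n - x) \<le> r + e}"
  have "M = K"
  proof (rule minimal_eq)
    show "M \<subseteq> K" by (auto simp: M_def)
    have "N (w n - z) \<le> r + e" if "0 < e" for e n using r[of n] that by linarith
    then have "z \<in> M" using z by (simp add: M_def)
    then show "M \<noteq> {}" by blast
    have "x \<in> M" if "x \<in> closure M" for x
    proof -
      have "x \<in> K" using that \<open>M \<subseteq> K\<close> closed_K by (meson closure_minimal subsetD)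
      moreover have "\<forall>\<^sub>F n in sequentially. N (w n - x) \<le> r + e" if e: "e > 0" for e
      proof -
        obtain y where y: "y \<in> M" "N (y - x) < e / 2"
          using \<open>x \<in> closure M\<close> e half_gt_zero[OF e] unfolding closure_N_approachable by blast
        have "\<forall>\<^sub>F n in sequentially. N (w n - y) \<le> r + e / 2" using y(1) e by (simp add: M_def)
        then show ?thesis
        proof eventually_elim
          case (elim n)
          then show ?case using N_triangle[of "w n" x y] y(2) by linarith
        qed
      qed
      ultimately show ?thesis by (simp add: M_def)
    qed
    then show "closed M" using closure_subset_eq by blast
    show "convex M"
    proof (rule convexI)
      fix x y and u v :: real
      assume xy: "x \<in> M" "y \<in> M" and uv: "0 \<le> u" "0 \<le> v" "u + v = 1"
      have "u *\<^sub>R x + v *\<^sub>R y \<in> K" using xy uv \<open>M \<subseteq> K\<close> convex_K by (meson convexD subsetD)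
      moreover have "\<forall>\<^sub>F n in sequentially. N (w n - (u *\<^sub>R x + v *\<^sub>R y)) \<le> r + e" if e: "e > 0" for e
      proof -
        have "\<forall>\<^sub>F n in sequentially. N (w n - x) \<le> r + e" "\<forall>\<^sub>F n in sequentially. N (w n - y) \<le> r + e"
          using xy e by (auto simp: M_def)
        then show ?thesis
        proof eventually_elim
          case (elim n)
          then have "x \<in> {x. N (x - w n) \<le> r + e}" "y \<in> {x. N (x - w n) \<le> r + e}"
            by (simp_all add: N_commute)
          then have "u *\<^sub>R x + v *\<^sub>R y \<in> {x. N (x - w n) \<le> r + e}"
            using uv by (intro convexD[OF convex_N_ball])
          then show ?case by (simp add: N_commute)
        qed
      qed
      ultimately show "u *\<^sub>R x + v *\<^sub>R y \<in> M" by (simp add: M_def)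
    qed
    fix x assume x: "x \<in> M"
    then have xK: "x \<in> K" by (simp add: M_def)
    have "\<forall>\<^sub>F n in sequentially. N (w n - T x) \<le> r + e" if e: "e > 0" for e
    proof -
      have "\<forall>\<^sub>F n in sequentially. N (w n - x) \<le> r + e / 2" using x e by (simp add: M_def)
      moreover have "\<forall>\<^sub>F n in sequentially. N (T (w n) - w n) < e / 2"
        using afp e by (intro order_tendstoD) auto
      ultimately show ?thesis
      proof eventually_elim
        case (elim n)
        then show ?case
          using N_triangle[of "w n" "T x" "T (w n)"] N_commute[of "w n" "T (w n)"] T_nonexpansive[OF w xK, of n]
          by linarith
      qed
    qed
    then show "T x \<in> M" using T_in[OF xK] by (simp add: M_def)
  qed
  obtain x where x: "x \<in> K" "\<forall>n. x \<in> closure (convex hull (w ` {n..}))"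
    using weak_cluster_point[where w = w, OF weakly_compact w] by blast
  have le: "N (y - x) \<le> r + e" if y: "y \<in> K" and e: "e > 0" for y e
  proof -
    have "\<forall>\<^sub>F n in sequentially. N (w n - y) \<le> r + e" using y e \<open>M = K\<close> by (auto simp: M_def)
    then obtain m where m: "\<And>n. n \<ge> m \<Longrightarrow> N (w n - y) \<le> r + e" by (auto simp: eventually_sequentially)
    have "closure (convex hull (w ` {m..})) \<subseteq> {x. N (x - y) \<le> r + e}"
      by (intro closure_minimal hull_minimal closed_N_ball convex_N_ball) (auto simp: m)
    then show ?thesis using x(2) by (auto simp: N_commute)
  qed
  have "N (y - x) \<le> r" if "y \<in> K" for y by (rule field_le_epsilon) (rule le[OF that])
  then show ?thesis by (rule diametral_point[OF x(1)])
qed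

text \<open>
  The Goebel--Karlovitz lemma, uniformly on compact sets: good approximate fixed points are almost
  diametral with respect to every point of \<open>A\<close>.  If this failed along a sequence, the limit of the
  corresponding points of \<open>A\<close> would contradict the bound for the asymptotic radius.
\<close>
lemma goebel_karlovitz_compact:
  assumes A: "compact A" "A \<subseteq> K" and e: "0 < e"
  shows "\<exists>\<delta>>0. \<forall>w\<in>K. N (T w - w) < \<delta> \<longrightarrow> (\<forall>z\<in>A. diam - e < N (w - z))"
proof (rule ccontr)
  assume neg: "\<not> ?thesis"
  have "\<exists>w z. w \<in> K \<and> z \<in> A \<and> N (T w - w) < 1 / real (Suc n) \<and> N (w - z) \<le> diam - e" for n
  proof -
    have "0 < 1 / real (Suc n)" by simp
    with neg have "\<not> (\<forall>w\<in>K. N (T w - w) < 1 / real (Suc n) \<longrightarrow> (\<forall>z\<in>A. diam - e < N (w - z)))" by blast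
    then show ?thesis by (auto simp: not_less)
  qed
  then obtain w z where wz: "\<And>n. w n \<in> K" "\<And>n. z n \<in> A" "\<And>n. N (T (w n) - w n) < 1 / real (Suc n)"
    "\<And>n. N (w n - z n) \<le> diam - e" by metis
  obtain a s where a: "a \<in> A" "strict_mono s" "(\<lambda>n. z (s n)) \<longlonglongrightarrow> a"
    using compact_imp_seq_compact[OF A(1)] wz(2) unfolding seq_compact_def o_def by metis
  have afp: "(\<lambda>n. N (T (w n) - w n)) \<longlonglongrightarrow> 0"
  proof (rule tendsto_sandwich[OF _ _ tendsto_const LIMSEQ_inverse_real_of_nat])
    show "\<forall>\<^sub>F n in sequentially. N (T (w n) - w n) \<le> inverse (real (Suc n))"
      using wz(3) by (intro always_eventually allI) (simp add: inverse_eq_divide less_imp_le)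
  qed (simp add: N_nonneg)
  have "isCont (\<lambda>x. N (x - a)) a"
    using continuous_on_N[of UNIV "\<lambda>x. x - a"] by (simp add: continuous_on_eq_continuous_at continuous_on_diff)
  then have "(\<lambda>n. N (z (s n) - a)) \<longlonglongrightarrow> N (a - a)" using a(3) by (rule isCont_tendsto_compose)
  then have "\<forall>\<^sub>F n in sequentially. N (z (s n) - a) < e / 2" using e by (intro order_tendstoD) auto
  then obtain m where m: "\<And>n. n \<ge> m \<Longrightarrow> N (z (s n) - a) < e / 2" by (auto simp: eventually_sequentially)
  have "diam \<le> diam - e / 2"
  proof (rule asymptotic_radius_ge_diam)
    show "w (s (n + m)) \<in> K" for n by (rule wz)
    have "filterlim (\<lambda>n. s (n + m)) sequentially sequentially"
      using filterlim_subseq[OF a(2)] by (rule filterlim_compose) (rule filterlim_add_const_nat_at_top)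
    with afp show "(\<lambda>n. N (T (w (s (n + m))) - w (s (n + m)))) \<longlonglongrightarrow> 0" by (rule filterlim_compose)
    show "a \<in> K" using a A by blast
    show "N (w (s (n + m)) - a) \<le> diam - e / 2" for n
      using N_triangle[of "w (s (n + m))" a "z (s (n + m))"] wz(4)[of "s (n + m)"] m[of "n + m"] by simp
  qed
  with e show False by simp
qed

end

section \<open>Stages of the generated invariant set\<close>

text \<open>
  The sets \<open>(segments T ^^ j) A\<close> exhaust the smallest convex set that contains \<open>A\<close> and is invariant
  under \<open>T\<close>.  Joining two points at a time, instead of forming the whole convex hull, keeps each stage
  compact when \<open>A\<close> is compact.
\<close>
definition segments :: "('v::real_vector \<Rightarrow> 'v) \<Rightarrow> 'v set \<Rightarrow> 'v set" where
  "segments T A = {(1 - t) *\<^sub>R x + t *\<^sub>R y | x y t. 0 \<le> t \<and> t \<le> 1 \<and> x \<in> A \<union> T ` A \<and> y \<in> A \<union> T ` A}"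

lemma segmentsI: "x \<in> A \<union> T ` A \<Longrightarrow> y \<in> A \<union> T ` A \<Longrightarrow> 0 \<le> t \<Longrightarrow> t \<le> 1 \<Longrightarrow> (1 - t) *\<^sub>R x + t *\<^sub>R y \<in> segments T A"
  unfolding segments_def by blast

lemma segmentsE:
  assumes "z \<in> segments T A"
  obtains x y t where "z = (1 - t) *\<^sub>R x + t *\<^sub>R y" "0 \<le> t" "t \<le> 1" "x \<in> A \<union> T ` A" "y \<in> A \<union> T ` A"
  using assms unfolding segments_def by blast

lemma segments_superset: "A \<union> T ` A \<subseteq> segments T A"
proof
  fix x assume "x \<in> A \<union> T ` A"
  from segmentsI[OF this this, of 0] show "x \<in> segments T A" by simp
qed

lemma segments_mono: "A \<subseteq> B \<Longrightarrow> segments T A \<subseteq> segments T B"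
  unfolding segments_def by blast

lemma segments_pow_mono: "A \<subseteq> B \<Longrightarrow> (segments T ^^ j) A \<subseteq> (segments T ^^ j) B"
  by (induction j) (simp_all add: segments_mono)

lemma segments_pow_increasing:
  assumes "j \<le> k"
  shows "(segments T ^^ j) A \<subseteq> (segments T ^^ k) A"
  using assms
proof (induction k rule: dec_induct)
  case (step k)
  then show ?case using segments_superset[where T = T and A = "(segments T ^^ k) A"] by auto
qed simp

text \<open>
  The stages are finitary: a point of a stage is built from finitely many points of the initial set.
\<close>
lemma segments_pow_UN:
  fixes A :: "nat \<Rightarrow> 'v::real_vector set"
  assumes "incseq A"
  shows "(segments T ^^ j) (\<Union>m. A m) = (\<Union>m. (segments T ^^ j) (A m))"
proof (induction j)
  case (Suc j)
  let ?B = "\<lambda>m. (segments T ^^ j) (A m)"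
  have inc: "?B m \<subseteq> ?B n" if "m \<le> n" for m n
    using assms that by (intro segments_pow_mono) (simp add: incseqD)
  have "segments T (\<Union>m. ?B m) \<subseteq> (\<Union>m. segments T (?B m))"
  proof
    fix z assume "z \<in> segments T (\<Union>m. ?B m)"
    then obtain x y t where z: "z = (1 - t) *\<^sub>R x + t *\<^sub>R y" "0 \<le> t" "t \<le> 1"
      and xy: "x \<in> (\<Union>m. ?B m) \<union> T ` (\<Union>m. ?B m)" "y \<in> (\<Union>m. ?B m) \<union> T ` (\<Union>m. ?B m)"
      by (rule segmentsE)
    obtain m n where "x \<in> ?B m \<union> T ` ?B m" "y \<in> ?B n \<union> T ` ?B n" using xy by blast
    then have "x \<in> ?B (max m n) \<union> T ` ?B (max m n)" "y \<in> ?B (max m n) \<union> T ` ?B (max m n)"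
      using inc[of m "max m n"] inc[of n "max m n"] by auto
    then have "z \<in> segments T (?B (max m n))" unfolding z(1) using z(2,3) by (rule segmentsI)
    then show "z \<in> (\<Union>m. segments T (?B m))" by (rule UN_I[OF UNIV_I])
  qed
  moreover have "(\<Union>m. segments T (?B m)) \<subseteq> segments T (\<Union>m. ?B m)"
    by (intro UN_least segments_mono) auto
  ultimately show ?case using Suc by auto
qed simp

lemma convex_hull_tail:
  fixes w :: "nat \<Rightarrow> 'v::real_vector"
  shows "convex hull (w ` {n..}) = (\<Union>m. convex hull (w ` {n..<m}))"
proof
  have inc: "convex hull (w ` {n..<l}) \<subseteq> convex hull (w ` {n..<m})" if "l \<le> m" for l m
    using that by (intro hull_mono image_mono) auto
  show "convex hull (w ` {n..}) \<subseteq> (\<Union>m. convex hull (w ` {n..<m}))"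
  proof (rule hull_minimal)
    show "w ` {n..} \<subseteq> (\<Union>m. convex hull (w ` {n..<m}))"
    proof
      fix x assume "x \<in> w ` {n..}"
      then obtain i where "x = w i" "n \<le> i" by auto
      then have "x \<in> convex hull (w ` {n..<Suc i})" by (intro hull_inc) auto
      then show "x \<in> (\<Union>m. convex hull (w ` {n..<m}))" by blast
    qed
    show "convex (\<Union>m. convex hull (w ` {n..<m}))"
    proof (rule convexI)
      fix x y and u v :: real
      assume xy: "x \<in> (\<Union>m. convex hull (w ` {n..<m}))" "y \<in> (\<Union>m. convex hull (w ` {n..<m}))"
        and uv: "0 \<le> u" "0 \<le> v" "u + v = 1"
      obtain l m where "x \<in> convex hull (w ` {n..<l})" "y \<in> convex hull (w ` {n..<m})" using xy by blast
      then have "x \<in> convex hull (w ` {n..<max l m})" "y \<in> convex hull (w ` {n..<max l m})"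
        using inc[of l "max l m"] inc[of m "max l m"] by auto
      then have "u *\<^sub>R x + v *\<^sub>R y \<in> convex hull (w ` {n..<max l m})"
        using uv by (intro convexD[OF convex_convex_hull])
      then show "u *\<^sub>R x + v *\<^sub>R y \<in> (\<Union>m. convex hull (w ` {n..<m}))" by blast
    qed
  qed
  show "(\<Union>m. convex hull (w ` {n..<m})) \<subseteq> convex hull (w ` {n..})"
    by (intro UN_least hull_mono image_mono) auto
qed

context minimal_nonexpansive begin

lemma segments_in_K: "A \<subseteq> K \<Longrightarrow> segments T A \<subseteq> K"
  using T_in convex_K_D by (auto elim!: segmentsE simp: subset_iff)

lemma segments_pow_in_K: "A \<subseteq> K \<Longrightarrow> (segments T ^^ j) A \<subseteq> K"
  by (induction j) (simp_all add: segments_in_K)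

lemma segments_pow_compact:
  assumes "A \<subseteq> K" "compact A"
  shows "compact ((segments T ^^ j) A)"
proof (induction j)
  case (Suc j)
  let ?B = "(segments T ^^ j) A"
  have "compact (T ` ?B)"
    using Suc segments_pow_in_K[OF assms(1)] continuous_on_T
    by (intro compact_continuous_image) (auto intro: continuous_on_subset)
  then have "compact (?B \<union> T ` ?B)" using Suc by blast
  from compact_convex_combinations[OF this this]
  have "compact (segments T ?B)" unfolding segments_def by (simp add: conj_assoc)
  then show ?case by simp
qed (simp add: assms)

text \<open>
  If \<open>w\<close> were a fixed point, balls around \<open>w\<close> would be invariant; an approximate fixed point loses at most
  \<open>e\<close> at each stage.
\<close>
lemma segments_pow_near:
  assumes A: "A \<subseteq> K" and w: "w \<in> K" "N (T w - w) \<le> e" and r: "\<forall>a\<in>A. N (a - w) \<le> r"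
  shows "z \<in> (segments T ^^ j) A \<Longrightarrow> N (z - w) \<le> r + real j * e"
proof (induction j arbitrary: z)
  case 0
  then show ?case using r by simp
next
  case (Suc j)
  have e: "0 \<le> e" using w(2) N_nonneg order_trans by blast
  have *: "x \<in> {x. N (x - w) \<le> r + real (Suc j) * e}" if "x \<in> (segments T ^^ j) A \<union> T ` (segments T ^^ j) A" for x
    using that
  proof
    assume "x \<in> (segments T ^^ j) A"
    then show ?thesis using Suc.IH[of x] e by (simp add: algebra_simps)
  next
    assume "x \<in> T ` (segments T ^^ j) A"
    then obtain y where y: "y \<in> (segments T ^^ j) A" "x = T y" by blast
    have "y \<in> K" using y(1) segments_pow_in_K[OF A] by blast
    then have "N (T y - w) \<le> N (y - w) + e"
      using N_triangle[of "T y" w "T w"] T_nonexpansive[of y w] w by simp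
    then show ?thesis using Suc.IH[OF y(1)] y(2) by (simp add: algebra_simps)
  qed
  obtain x y t where z: "z = (1 - t) *\<^sub>R x + t *\<^sub>R y" "0 \<le> t" "t \<le> 1"
      "x \<in> (segments T ^^ j) A \<union> T ` (segments T ^^ j) A" "y \<in> (segments T ^^ j) A \<union> T ` (segments T ^^ j) A"
    using Suc.prems by (auto elim: segmentsE)
  have "z \<in> {x. N (x - w) \<le> r + real (Suc j) * e}"
    unfolding z(1) using z * by (intro convexD[OF convex_N_ball]) auto
  then show ?case by simp
qed

text \<open>
  The points that lie, up to the error \<open>r\<close>, metrically between some point of \<open>B\<close> and \<open>w\<close>, when \<open>w\<close> is
  at distance \<open>diam\<close> from \<open>B\<close>.  The two distances are bounded by fixed fractions of \<open>diam\<close>, rather than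
  by a condition on their sum, so that the relation survives convex combinations.
\<close>
definition metrically_between :: "'v set \<Rightarrow> 'v \<Rightarrow> real \<Rightarrow> 'v set" where
  "metrically_between B w r = {z. \<exists>z'\<in>B. \<exists>t. 0 \<le> t \<and> t \<le> 1 \<and> N (z - z') \<le> t * diam \<and> N (z - w) \<le> (1 - t) * diam + r}"

lemma betweenI: "z' \<in> B \<Longrightarrow> 0 \<le> t \<Longrightarrow> t \<le> 1 \<Longrightarrow> N (z - z') \<le> t * diam \<Longrightarrow> N (z - w) \<le> (1 - t) * diam + r \<Longrightarrow> z \<in> metrically_between B w r"
  unfolding metrically_between_def by blast

lemma between_sum:
  assumes "z \<in> metrically_between B w r"
  shows "\<exists>z'\<in>B. N (z - z') + N (z - w) \<le> diam + r"
proof -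
  obtain z' t where "z' \<in> B" "N (z - z') \<le> t * diam" "N (z - w) \<le> (1 - t) * diam + r"
    using assms unfolding metrically_between_def by blast
  then show ?thesis by (intro bexI[of _ z']) (auto simp: algebra_simps)
qed

text \<open>
  If \<open>z\<close> lies between \<open>z'\<close> and the approximate fixed point \<open>w\<close>, then \<open>T z\<close> lies between \<open>T z'\<close> and \<open>w\<close>,
  by nonexpansiveness; convex combinations are taken in \<open>z\<close>, \<open>z'\<close> and the fraction simultaneously.
\<close>
lemma between_segments:
  assumes A: "A \<subseteq> K" and B: "B \<subseteq> K" and w: "w \<in> K" "N (T w - w) \<le> e" and sub: "A \<subseteq> metrically_between B w r"
  shows "segments T A \<subseteq> metrically_between (segments T B) w (r + e)"
proof
  fix z assume z: "z \<in> segments T A"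
  have e: "0 \<le> e" using w(2) N_nonneg order_trans by blast
  have *: "\<exists>x'\<in>B \<union> T ` B. \<exists>t. 0 \<le> t \<and> t \<le> 1 \<and> N (x - x') \<le> t * diam \<and> N (x - w) \<le> (1 - t) * diam + (r + e)"
    if "x \<in> A \<union> T ` A" for x
    using that
  proof
    assume "x \<in> A"
    then obtain x' t where "x' \<in> B" "0 \<le> t" "t \<le> 1" "N (x - x') \<le> t * diam" "N (x - w) \<le> (1 - t) * diam + r"
      using sub unfolding metrically_between_def by blast
    then show ?thesis using e by (intro bexI[of _ x'] exI[of _ t]) auto
  next
    assume "x \<in> T ` A"
    then obtain y where y: "y \<in> A" "x = T y" by blast
    then obtain y' t where y': "y' \<in> B" "0 \<le> t" "t \<le> 1" "N (y - y') \<le> t * diam" "N (y - w) \<le> (1 - t) * diam + r"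
      using sub unfolding metrically_between_def by blast
    have K: "y \<in> K" "y' \<in> K" using y y' A B by auto
    have "N (x - T y') \<le> t * diam" using T_nonexpansive[OF K] y'(4) y(2) by simp
    moreover have "N (x - w) \<le> (1 - t) * diam + (r + e)"
      using N_triangle[of x w "T w"] T_nonexpansive[OF K(1) w(1)] w(2) y(2) y'(5) by simp
    ultimately show ?thesis using y' by (intro bexI[of _ "T y'"] exI[of _ t]) auto
  qed
  obtain x y s where xy: "z = (1 - s) *\<^sub>R x + s *\<^sub>R y" "0 \<le> s" "s \<le> 1" "x \<in> A \<union> T ` A" "y \<in> A \<union> T ` A"
    using z by (rule segmentsE)
  obtain x' t where x': "x' \<in> B \<union> T ` B" "0 \<le> t" "t \<le> 1" "N (x - x') \<le> t * diam" "N (x - w) \<le> (1 - t) * diam + (r + e)"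
    using *[OF xy(4)] by blast
  obtain y' u where y': "y' \<in> B \<union> T ` B" "0 \<le> u" "u \<le> 1" "N (y - y') \<le> u * diam" "N (y - w) \<le> (1 - u) * diam + (r + e)"
    using *[OF xy(5)] by blast
  define v where "v = (1 - s) * t + s * u"
  show "z \<in> metrically_between (segments T B) w (r + e)"
  proof (rule betweenI)
    show "(1 - s) *\<^sub>R x' + s *\<^sub>R y' \<in> segments T B" using x' y' xy by (intro segmentsI)
    show "0 \<le> v" using x' y' xy by (simp add: v_def)
    have "v \<le> (1 - s) * 1 + s * 1" unfolding v_def using x' y' xy by (intro add_mono mult_left_mono) auto
    then show "v \<le> 1" by simp
    have "N (z - ((1 - s) *\<^sub>R x' + s *\<^sub>R y')) \<le> (1 - s) * N (x - x') + s * N (y - y')"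
      unfolding xy(1) using xy by (intro N_convex)
    also have "\<dots> \<le> (1 - s) * (t * diam) + s * (u * diam)"
      using x' y' xy by (intro add_mono mult_left_mono) auto
    finally show "N (z - ((1 - s) *\<^sub>R x' + s *\<^sub>R y')) \<le> v * diam" by (simp add: v_def algebra_simps)
    have "N (z - w) \<le> (1 - s) * N (x - w) + s * N (y - w)"
    proof -
      have "(1 - s) *\<^sub>R w + s *\<^sub>R w = w" by (simp flip: scaleR_left_distrib)
      then show ?thesis using N_convex[OF xy(2,3), of x y w w] xy(1) by simp
    qed
    also have "\<dots> \<le> (1 - s) * ((1 - t) * diam + (r + e)) + s * ((1 - u) * diam + (r + e))"
      using x' y' xy by (intro add_mono mult_left_mono) auto
    finally show "N (z - w) \<le> (1 - v) * diam + (r + e)" by (simp add: v_def algebra_simps)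
  qed
qed

text \<open>
  Adding the generator \<open>w\<close> to \<open>S\<close> produces, at each stage, only points that lie between \<open>w\<close> and what
  \<open>S\<close> alone generates at that stage.
\<close>
lemma between_segments_pow:
  assumes S: "S \<subseteq> K" "S \<noteq> {}" and w: "w \<in> K" "N (T w - w) \<le> e"
  shows "(segments T ^^ j) (convex hull (insert w S)) \<subseteq> metrically_between ((segments T ^^ j) (convex hull S)) w (real j * e)"
proof (induction j)
  case 0
  have hS: "convex hull S \<subseteq> K" using S(1) convex_K by (rule hull_minimal)
  show ?case
  proof
    fix z assume "z \<in> (segments T ^^ 0) (convex hull (insert w S))"
    then obtain u v z' where z: "0 \<le> u" "0 \<le> v" "u + v = 1" "z' \<in> convex hull S" "z = u *\<^sub>R w + v *\<^sub>R z'"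
      using convex_hull_insert[OF S(2), of w] by auto
    have v: "v = 1 - u" using z by simp
    have z'K: "z' \<in> K" using z(4) hS by blast
    have "z - z' = u *\<^sub>R (w - z')" "z - w = (1 - u) *\<^sub>R (z' - w)" by (simp_all add: z(5) v algebra_simps)
    then have "N (z - z') = u * N (w - z')" "N (z - w) = (1 - u) * N (z' - w)"
      using z v by (simp_all add: N_scale)
    moreover have "u * N (w - z') \<le> u * diam" "(1 - u) * N (z' - w) \<le> (1 - u) * diam"
      using z v z'K w diam_upper by (auto intro!: mult_left_mono)
    ultimately show "z \<in> metrically_between ((segments T ^^ 0) (convex hull S)) w (real 0 * e)"
      using z v by (intro betweenI[of z' _ u]) auto
  qed
next
  case (Suc j)
  have "convex hull (insert w S) \<subseteq> K" "convex hull S \<subseteq> K" using S(1) w(1) convex_K by (simp_all add: subset_hull)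
  then have "segments T ((segments T ^^ j) (convex hull (insert w S)))
    \<subseteq> metrically_between (segments T ((segments T ^^ j) (convex hull S))) w (real j * e + e)"
    using w Suc.IH by (intro between_segments segments_pow_in_K)
  then show ?case by (simp add: algebra_simps)
qed

end

section \<open>Functions that are monotone along metric segments\<close>

context minimal_nonexpansive begin

text \<open>
  The heart of the proof, to be applied with the norm of the second component as \<open>\<rho>\<close>.  The function
  \<open>\<rho>\<close> is monotone along metric segments: a point almost between \<open>x\<close> and \<open>y\<close> has at most slightly
  larger \<open>\<rho>\<close>-distance from \<open>y\<close> than \<open>x\<close> has.  The approximate fixed points \<open>w m\<close>
  are chosen inductively, \<open>\<rho>\<close>-close to \<open>q\<close>, and so good that they are almost diametral to everything
  that the earlier ones generate in at most \<open>m\<close> stages (a compact set).  For a fixed number \<open>j\<close> of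
  stages, each new generator \<open>w m\<close> then creates only points between \<open>w m\<close> and earlier points, and so
  increases the \<open>\<rho>\<close>-distance from \<open>q\<close> by a summable error.  Hence \<open>G j n\<close>, the \<open>j\<close>-th stage generated
  by the tail from \<open>n\<close> on, approaches \<open>q\<close> with respect to \<open>\<rho>\<close> as \<open>n\<close> grows.

  The errors cannot be controlled for all \<open>j\<close> simultaneously, because already a single \<open>w n\<close> generates a
  dense part of \<open>K\<close>.  So \<open>j\<close> is kept fixed while \<open>n\<close> tends to infinity: the intersection of the
  closures of \<open>G j n\<close> over all \<open>n\<close> lies in the zero set of \<open>\<lambda>z. \<rho> (z - q)\<close>.  For \<open>j = 0\<close> it contains the weak
  cluster points of \<open>w\<close>, and \<open>T\<close> maps the intersection for \<open>j\<close> into that for \<open>j + 1\<close>.  The union \<open>E\<close> over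
  \<open>j\<close> is therefore nonempty, convex and invariant, so it is dense in \<open>K\<close> by minimality.
\<close>
theorem seminorm_vanishes_on_minimal_set:
  fixes \<rho> :: "'v \<Rightarrow> real" and q :: 'v
  assumes \<rho>_add: "\<And>x y. \<rho> (x + y) \<le> \<rho> x + \<rho> y" and \<rho>_minus: "\<And>x. \<rho> (- x) = \<rho> x"
    and \<rho>_nonneg: "\<And>x. 0 \<le> \<rho> x" and \<rho>_N: "\<And>x. \<rho> x \<le> \<beta> * N x"
    and monotone: "\<And>\<epsilon>. 0 < \<epsilon> \<Longrightarrow> \<exists>\<eta>>0. \<forall>x\<in>K. \<forall>z\<in>K. \<forall>y\<in>K.
        N (z - x) + N (z - y) \<le> N (y - x) + \<eta> \<longrightarrow> \<rho> (z - y) \<le> \<rho> (x - y) + \<epsilon>"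
    and afp: "\<And>\<delta>. 0 < \<delta> \<Longrightarrow> \<exists>w\<in>K. N (T w - w) < \<delta> \<and> \<rho> (w - q) < \<delta>"
    and z: "z \<in> K"
  shows "\<rho> (z - q) = 0"
proof -
  have \<rho>_triangle: "\<rho> (x - z) \<le> \<rho> (x - y) + \<rho> (y - z)" for x y z
    using \<rho>_add[of "x - y" "y - z"] by simp
  have \<rho>_commute: "\<rho> (x - y) = \<rho> (y - x)" for x y
    using \<rho>_minus[of "x - y"] by simp
  define h where "h m = (1 / 2 :: real) ^ m" for m
  have h: "0 < h m" for m by (simp add: h_def)
  obtain \<eta> where \<eta>: "\<And>m. 0 < \<eta> m" and mono: "\<And>m x z y. x \<in> K \<Longrightarrow> z \<in> K \<Longrightarrow> y \<in> K \<Longrightarrow>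
      N (z - x) + N (z - y) \<le> N (y - x) + \<eta> m \<Longrightarrow> \<rho> (z - y) \<le> \<rho> (x - y) + h m"
  proof -
    have "\<forall>m. \<exists>\<eta>>0. \<forall>x\<in>K. \<forall>z\<in>K. \<forall>y\<in>K. N (z - x) + N (z - y) \<le> N (y - x) + \<eta> \<longrightarrow> \<rho> (z - y) \<le> \<rho> (x - y) + h m"
      using monotone[OF h] by blast
    from choice[OF this] obtain \<eta> where "\<forall>m. 0 < \<eta> m \<and> (\<forall>x\<in>K. \<forall>z\<in>K. \<forall>y\<in>K. N (z - x) + N (z - y) \<le> N (y - x) + \<eta> m \<longrightarrow> \<rho> (z - y) \<le> \<rho> (x - y) + h m)"
      by blast
    then show thesis by (intro that[of \<eta>]) auto
  qed
  \<comment> \<open>The division by \<open>m + 1\<close> pays for the at most \<open>m\<close> stages in which the error \<open>e m\<close> accumulates.\<close>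
  define e where "e m = min (h m) (\<eta> m / 2) / (real m + 1)" for m
  have e: "0 < e m" for m using h[of m] \<eta>[of m] by (simp add: e_def)
  have e_h: "real j * e m \<le> h m" and e_\<eta>: "real j * e m \<le> \<eta> m / 2" if "j \<le> m" for j m
  proof -
    have "real j * e m \<le> (real m + 1) * e m" using that e[of m] by (intro mult_right_mono) auto
    then have "real j * e m \<le> min (h m) (\<eta> m / 2)" by (simp add: e_def)
    then show "real j * e m \<le> h m" "real j * e m \<le> \<eta> m / 2" by auto
  qed
  \<comment> \<open>The condition on \<open>w m\<close> refers to all earlier values; the premise \<open>f ` {..<m} \<subseteq> K\<close> makes it
    satisfiable for arbitrary \<open>f\<close>.\<close>
  let ?good = "\<lambda>f m r. f ` {..<m} \<subseteq> K \<longrightarrow> r \<in> K \<and> N (T r - r) \<le> e m \<and> \<rho> (r - q) \<le> h m \<and>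
    (\<forall>x\<in>(segments T ^^ m) (convex hull (f ` {..<m})). diam - \<eta> m / 2 < N (r - x))"
  have "\<exists>w. \<forall>m. ?good w m (w m)"
  proof (rule dependent_wellorder_choice)
    fix r :: 'v and f g :: "nat \<Rightarrow> 'v" and m :: nat
    assume "\<And>i. i < m \<Longrightarrow> f i = g i"
    then have "f ` {..<m} = g ` {..<m}" by (intro image_cong) auto
    then show "?good f m r = ?good g m r" by simp
  next
    fix m and f :: "nat \<Rightarrow> 'v"
    show "\<exists>r. ?good f m r"
    proof (cases "f ` {..<m} \<subseteq> K")
      case True
      let ?A = "(segments T ^^ m) (convex hull (f ` {..<m}))"
      have hull: "convex hull (f ` {..<m}) \<subseteq> K" using True convex_K by (rule hull_minimal)
      have "compact ?A" using hull by (intro segments_pow_compact finite_imp_compact_convex_hull) auto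
      moreover have "?A \<subseteq> K" using hull by (rule segments_pow_in_K)
      moreover have "0 < \<eta> m / 2" using \<eta>[of m] by simp
      ultimately obtain \<delta> where \<delta>: "\<delta> > 0" "\<forall>w\<in>K. N (T w - w) < \<delta> \<longrightarrow> (\<forall>z\<in>?A. diam - \<eta> m / 2 < N (w - z))"
        using goebel_karlovitz_compact by blast
      obtain r where r: "r \<in> K" "N (T r - r) < min \<delta> (min (e m) (h m))" "\<rho> (r - q) < min \<delta> (min (e m) (h m))"
        using afp[of "min \<delta> (min (e m) (h m))"] \<delta>(1) e[of m] h[of m] by auto
      have "N (T r - r) < \<delta>" using r(2) by simp
      then have "\<forall>x\<in>?A. diam - \<eta> m / 2 < N (r - x)" using \<delta>(2) r(1) by blast
      then show ?thesis using r by (intro exI[of _ r]) auto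
    qed auto
  qed
  then obtain w where good: "\<forall>m. ?good w m (w m)" ..
  have wK: "w m \<in> K" for m
  proof (induction m rule: less_induct)
    case (less m)
    then have "w ` {..<m} \<subseteq> K" by auto
    then show ?case using spec[OF good, of m] by blast
  qed
  then have wK_image: "w ` I \<subseteq> K" for I by blast
  have w_afp: "N (T (w m) - w m) \<le> e m" and w_q: "\<rho> (w m - q) \<le> h m"
    and w_far: "\<And>x. x \<in> (segments T ^^ m) (convex hull (w ` {..<m})) \<Longrightarrow> diam - \<eta> m / 2 < N (w m - x)" for m
    using spec[OF good, of m] wK_image by auto
  have hull_K: "convex hull (w ` I) \<subseteq> K" for I using wK_image convex_K by (rule hull_minimal)
  define D where "D j n m = (segments T ^^ j) (convex hull (w ` {n..<m}))" for j n m
  have D_K: "D j n m \<subseteq> K" for j n m unfolding D_def using hull_K by (rule segments_pow_in_K)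
  \<comment> \<open>Of the three terms \<open>h m\<close>, one comes from \<open>mono\<close> and two from passing between \<open>w m\<close> and \<open>q\<close>.\<close>
  have step: "\<rho> (x - q) \<le> s + 3 * h m"
    if x: "x \<in> D j n (Suc m)" and jm: "j \<le> m" "n < m" and s: "\<forall>y\<in>D j n m. \<rho> (y - q) \<le> s" for x j n m s
  proof -
    have "w ` {n..<Suc m} = insert (w m) (w ` {n..<m})" using jm by (simp add: atLeastLessThanSuc)
    then have "x \<in> metrically_between (D j n m) (w m) (real j * e m)"
      using between_segments_pow[OF wK_image _ wK w_afp, of "{n..<m}" j m] x jm unfolding D_def by auto
    then obtain y where y: "y \<in> D j n m" "N (x - y) + N (x - w m) \<le> diam + real j * e m"
      using between_sum by blast
    have "D j n m \<subseteq> (segments T ^^ m) (convex hull (w ` {n..<m}))"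
      unfolding D_def using jm(1) by (rule segments_pow_increasing)
    also have "\<dots> \<subseteq> (segments T ^^ m) (convex hull (w ` {..<m}))"
      by (intro segments_pow_mono hull_mono image_mono) auto
    finally have "diam - \<eta> m / 2 < N (w m - y)" using y(1) w_far by blast
    then have "N (x - y) + N (x - w m) \<le> N (w m - y) + \<eta> m" using y(2) e_\<eta>[OF jm(1)] by linarith
    then have "\<rho> (x - w m) \<le> \<rho> (y - w m) + h m"
      using x y(1) D_K wK by (intro mono) auto
    then show ?thesis
      using \<rho>_triangle[of x q "w m"] \<rho>_triangle[of y "w m" q] \<rho>_commute[of q "w m"] w_q[of m] bspec[OF s y(1)] by linarith
  qed
  \<comment> \<open>The factor \<open>1 - h k\<close> is the sum of \<open>h i\<close> for \<open>i = 1, \<dots>, k\<close>, from the errors of \<open>k\<close> further generators.\<close>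
  have bound: "\<forall>x\<in>D j n (Suc (n + k)). \<rho> (x - q) \<le> (\<bar>\<beta>\<bar> + 1) * h n + 3 * h n * (1 - h k)" if jn: "j \<le> n" for j n k
  proof (induction k)
    case 0
    have "\<rho> (x - q) \<le> (\<bar>\<beta>\<bar> + 1) * h n" if x: "x \<in> D j n (Suc n)" for x
    proof -
      have "x \<in> (segments T ^^ j) {w n}" using x by (simp add: D_def)
      then have "N (x - w n) \<le> 0 + real j * e n"
        using wK w_afp by (intro segments_pow_near[of "{w n}"]) auto
      then have "\<bar>\<beta>\<bar> * N (x - w n) \<le> \<bar>\<beta>\<bar> * h n" using e_h[OF jn] by (intro mult_left_mono) auto
      moreover have "\<rho> (x - w n) \<le> \<bar>\<beta>\<bar> * N (x - w n)"
        using \<rho>_N[of "x - w n"] N_nonneg[of "x - w n"] by (meson abs_ge_self mult_right_mono order_trans)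
      ultimately show ?thesis using \<rho>_triangle[of x q "w n"] w_q[of n] by (simp add: algebra_simps)
    qed
    then show ?case by (simp add: h_def)
  next
    case (Suc k)
    have "3 * h n * (1 - h k) + 3 * h (Suc (n + k)) = 3 * h n * (1 - h (Suc k))"
      by (simp add: h_def power_add algebra_simps)
    moreover have "\<rho> (x - q) \<le> ((\<bar>\<beta>\<bar> + 1) * h n + 3 * h n * (1 - h k)) + 3 * h (Suc (n + k))"
      if "x \<in> D j n (Suc (n + Suc k))" for x
      using that jn by (intro step[OF _ _ _ Suc]) auto
    ultimately show ?case by (simp add: add.assoc)
  qed
  define G where "G j n = (segments T ^^ j) (convex hull (w ` {n..}))" for j n
  have G_K: "G j n \<subseteq> K" for j n unfolding G_def using hull_K by (rule segments_pow_in_K)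
  have G_bound: "\<rho> (x - q) \<le> (\<bar>\<beta>\<bar> + 4) * h n" if x: "x \<in> G j n" and jn: "j \<le> n" for x j n
  proof -
    have inc: "incseq (\<lambda>m. convex hull (w ` {n..<m}))"
      by (intro monoI hull_mono image_mono) auto
    have "G j n = (\<Union>m. D j n m)"
      unfolding G_def D_def convex_hull_tail by (rule segments_pow_UN[OF inc])
    then obtain m where "x \<in> D j n m" using x by blast
    moreover have "D j n m \<subseteq> D j n (Suc (n + m))"
      unfolding D_def by (intro segments_pow_mono hull_mono image_mono) auto
    ultimately have "\<rho> (x - q) \<le> (\<bar>\<beta>\<bar> + 1) * h n + 3 * h n * (1 - h m)" using bound[OF jn, of m] by blast
    also have "\<dots> \<le> (\<bar>\<beta>\<bar> + 1) * h n + 3 * h n * 1"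
      using h[of n] h[of m] by (intro add_left_mono mult_left_mono) auto
    finally show ?thesis by (simp add: algebra_simps)
  qed
  have G_mono: "G i n \<subseteq> G j n" if "i \<le> j" for i j n
    unfolding G_def using that by (rule segments_pow_increasing)
  define E where "E = (\<Union>j. \<Inter>n. closure (G j n))"
  have E_K: "E \<subseteq> K"
  proof -
    have "closure (G j n) \<subseteq> K" for j n using G_K closed_K by (rule closure_minimal)
    then show ?thesis unfolding E_def by blast
  qed
  have E_ne: "E \<noteq> {}"
  proof -
    obtain x where "\<forall>n. x \<in> closure (convex hull (w ` {n..}))"
      using weak_cluster_point[where w = w, OF weakly_compact wK] by blast
    then have "x \<in> (\<Inter>n. closure (G 0 n))" by (simp add: G_def)
    then show ?thesis unfolding E_def by blast
  qed
  have E_convex: "convex E"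
  proof (rule convexI)
    fix x y and u v :: real assume xy: "x \<in> E" "y \<in> E" and uv: "0 \<le> u" "0 \<le> v" "u + v = 1"
    have u: "u = 1 - v" using uv by simp
    obtain i where i: "\<forall>n. x \<in> closure (G i n)" using xy(1) unfolding E_def by auto
    obtain j where j: "\<forall>n. y \<in> closure (G j n)" using xy(2) unfolding E_def by auto
    define k where "k = max i j"
    have "u *\<^sub>R x + v *\<^sub>R y \<in> closure (G (Suc k) n)" for n
      unfolding closure_N_approachable
    proof (intro allI impI)
      fix d :: real assume d: "d > 0"
      have "closure (G i n) \<subseteq> closure (G k n)" "closure (G j n) \<subseteq> closure (G k n)"
        unfolding k_def by (intro closure_mono G_mono; simp)+
      with i j have "x \<in> closure (G k n)" "y \<in> closure (G k n)" by auto
      then obtain x' y' where x': "x' \<in> G k n" "N (x' - x) < d" and y': "y' \<in> G k n" "N (y' - y) < d"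
        using d unfolding closure_N_approachable by meson
      have "(1 - v) *\<^sub>R x' + v *\<^sub>R y' \<in> segments T (G k n)" using x' y' uv by (intro segmentsI) auto
      then have "(1 - v) *\<^sub>R x' + v *\<^sub>R y' \<in> G (Suc k) n" by (simp add: G_def)
      moreover have "N (((1 - v) *\<^sub>R x' + v *\<^sub>R y') - (u *\<^sub>R x + v *\<^sub>R y)) < d"
      proof -
        have "N (((1 - v) *\<^sub>R x' + v *\<^sub>R y') - ((1 - v) *\<^sub>R x + v *\<^sub>R y)) \<le> (1 - v) * N (x' - x) + v * N (y' - y)"
          using uv by (intro N_convex) auto
        also have "\<dots> < d"
          using convex_bound_lt[OF x'(2) y'(2), of "1 - v" v] uv by simp
        finally show ?thesis by (simp add: u)
      qed
      ultimately show "\<exists>z\<in>G (Suc k) n. N (z - (u *\<^sub>R x + v *\<^sub>R y)) < d" by blast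
    qed
    then show "u *\<^sub>R x + v *\<^sub>R y \<in> E" unfolding E_def by blast
  qed
  have E_T: "T x \<in> E" if x: "x \<in> E" for x
  proof -
    obtain j where j: "\<forall>n. x \<in> closure (G j n)" using x unfolding E_def by auto
    have "T x \<in> closure (G (Suc j) n)" for n
      unfolding closure_N_approachable
    proof (intro allI impI)
      fix d :: real assume "d > 0"
      then obtain x' where x': "x' \<in> G j n" "N (x' - x) < d"
        using spec[OF j, of n] unfolding closure_N_approachable by blast
      have "T x' \<in> segments T (G j n)" using x'(1) segments_superset by blast
      then have "T x' \<in> G (Suc j) n" by (simp add: G_def)
      moreover have "N (T x' - T x) < d"
        using T_nonexpansive[of x' x] x' x E_K G_K by (meson le_less_trans subsetD)
      ultimately show "\<exists>z\<in>G (Suc j) n. N (z - T x) < d" by blast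
    qed
    then show ?thesis unfolding E_def by blast
  qed
  have "closure E = K"
  proof (rule minimal_eq)
    show EK: "closure E \<subseteq> K" using E_K closed_K by (rule closure_minimal)
    show "closure E \<noteq> {}" using E_ne by simp
    show "convex (closure E)" using E_convex by (rule convex_closure)
    show "T x \<in> closure E" if x: "x \<in> closure E" for x
      unfolding closure_N_approachable
    proof (intro allI impI)
      fix d :: real assume "d > 0"
      then obtain x' where x': "x' \<in> E" "N (x' - x) < d" using x unfolding closure_N_approachable by blast
      have "N (T x' - T x) < d"
        using T_nonexpansive[of x' x] x' x E_K EK by (meson le_less_trans subsetD)
      with E_T[OF x'(1)] show "\<exists>y\<in>E. N (y - T x) < d" by blast
    qed
  qed simp
  have E_bound: "\<rho> (x - q) \<le> \<epsilon>" if x: "x \<in> E" and \<epsilon>: "0 < \<epsilon>" for x \<epsilon>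
  proof -
    obtain j where j: "\<forall>n. x \<in> closure (G j n)" using x unfolding E_def by auto
    have "(\<lambda>n. (\<bar>\<beta>\<bar> + 4) * h n) \<longlonglongrightarrow> (\<bar>\<beta>\<bar> + 4) * 0"
      unfolding h_def by (intro tendsto_mult tendsto_const LIMSEQ_power_zero) simp
    from order_tendstoD(2)[OF this, of "\<epsilon> / 2"]
    have "\<forall>\<^sub>F n in sequentially. (\<bar>\<beta>\<bar> + 4) * h n < \<epsilon> / 2" using \<epsilon> by simp
    then obtain m where m: "\<And>n. n \<ge> m \<Longrightarrow> (\<bar>\<beta>\<bar> + 4) * h n < \<epsilon> / 2" by (auto simp: eventually_sequentially)
    define n where "n = max j m"
    have "0 < \<epsilon> / 2 / (\<bar>\<beta>\<bar> + 1)" using \<epsilon> by (intro divide_pos_pos) auto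
    then obtain y where y: "y \<in> G j n" "N (y - x) < \<epsilon> / 2 / (\<bar>\<beta>\<bar> + 1)"
      using spec[OF j, of n] unfolding closure_N_approachable by blast
    have "\<rho> (y - x) \<le> \<beta> * N (y - x)" by (rule \<rho>_N)
    also have "\<dots> \<le> (\<bar>\<beta>\<bar> + 1) * N (y - x)" using N_nonneg by (intro mult_right_mono) auto
    also have "\<dots> \<le> \<epsilon> / 2" using y(2) by (simp add: field_simps)
    finally have "\<rho> (x - y) \<le> \<epsilon> / 2" by (simp add: \<rho>_commute)
    moreover have "\<rho> (y - q) \<le> \<epsilon> / 2"
      using G_bound[OF y(1)] m[of n] by (simp add: n_def)
    ultimately show ?thesis using \<rho>_triangle[of x q y] by linarith
  qed
  have small: "\<rho> (z - q) \<le> 0 + \<epsilon>" if \<epsilon>: "0 < \<epsilon>" for \<epsilon>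
  proof -
    have "0 < \<epsilon> / 2 / (\<bar>\<beta>\<bar> + 1)" using \<epsilon> by (intro divide_pos_pos) auto
    moreover have "z \<in> closure E" using z \<open>closure E = K\<close> by simp
    ultimately obtain y where y: "y \<in> E" "N (y - z) < \<epsilon> / 2 / (\<bar>\<beta>\<bar> + 1)"
      unfolding closure_N_approachable by blast
    have "\<rho> (y - z) \<le> \<beta> * N (y - z)" by (rule \<rho>_N)
    also have "\<dots> \<le> (\<bar>\<beta>\<bar> + 1) * N (y - z)" using N_nonneg by (intro mult_right_mono) auto
    also have "\<dots> \<le> \<epsilon> / 2" using y(2) by (simp add: field_simps)
    finally have "\<rho> (z - y) \<le> \<epsilon> / 2" by (simp add: \<rho>_commute)
    moreover have "\<rho> (y - q) \<le> \<epsilon> / 2" using E_bound[OF y(1), of "\<epsilon> / 2"] \<epsilon> by simp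
    ultimately show ?thesis using \<rho>_triangle[of z q y] by linarith
  qed
  have "\<rho> (z - q) \<le> 0" by (rule field_le_epsilon) (rule small)
  with \<rho>_nonneg[of "z - q"] show ?thesis by simp
qed

end

section \<open>Strictly monotone direct sums\<close>

text \<open>
  The span of \<open>B\<close> is closed by the induction hypothesis, so a new vector \<open>b\<close> outside of it has
  positive distance from it; this bounds the \<open>b\<close>-coordinates of a bounded sequence.
\<close>
lemma finite_span_convergent_subsequence:
  fixes x :: "nat \<Rightarrow> 'b::real_normed_vector"
  assumes "finite B" "\<And>n. x n \<in> span B" "bounded (range x)"
  shows "\<exists>l\<in>span B. \<exists>r. strict_mono r \<and> (\<lambda>n. x (r n)) \<longlonglongrightarrow> l"
  using assms
proof (induction B arbitrary: x rule: finite_induct)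
  case empty
  then show ?case by (auto intro!: exI[of _ id] strict_monoI)
next
  case (insert b B)
  show ?case
  proof (cases "b \<in> span B")
    case True
    then have eq: "span (insert b B) = span B" by (rule span_redundant)
    show ?thesis unfolding eq using insert.prems unfolding eq by (rule insert.IH)
  next
    case False
    have closed: "closed (span B)"
      unfolding closed_sequential_limits
    proof (intro allI impI)
      fix v l assume v: "(\<forall>n. v n \<in> span B) \<and> v \<longlonglongrightarrow> l"
      then obtain l' r where l': "l' \<in> span B" "strict_mono r" "(\<lambda>n. v (r n)) \<longlonglongrightarrow> l'"
        using insert.IH[of v] convergent_imp_bounded[of v l] by auto
      have "(\<lambda>n. v (r n)) \<longlonglongrightarrow> l" using LIMSEQ_subseq_LIMSEQ[of v l r] v l'(2) by (simp add: o_def)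
      with l'(1,3) show "l \<in> span B" using LIMSEQ_unique by blast
    qed
    then have "open (- span B)" "b \<in> - span B" using False by auto
    then obtain \<delta> where \<delta>: "\<delta> > 0" "ball b \<delta> \<subseteq> - span B" by (meson open_contains_ball)
    have far: "\<delta> \<le> norm (b - v)" if "v \<in> span B" for v
    proof -
      have "v \<notin> ball b \<delta>" using \<delta>(2) that by blast
      then show ?thesis by (simp add: dist_norm)
    qed
    have "\<exists>t. x n - t *\<^sub>R b \<in> span B" for n
      using insert.prems(1)[of n] by (simp add: span_breakdown_eq)
    then obtain t where t: "\<And>n. x n - t n *\<^sub>R b \<in> span B" by metis
    obtain M where M: "\<And>n. norm (x n) \<le> M" using insert.prems(2) unfolding bounded_iff by auto
    have t_le: "norm (t n) \<le> M / \<delta>" for n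
    proof (cases "t n = 0")
      case True
      then show ?thesis using order_trans[OF norm_ge_zero M] \<delta>(1) by simp
    next
      case False
      define v where "v = (- (1 / t n)) *\<^sub>R (x n - t n *\<^sub>R b)"
      have "v \<in> span B" unfolding v_def by (intro span_scale t)
      moreover have "x n = t n *\<^sub>R (b - v)" using False by (simp add: v_def algebra_simps)
      ultimately have "\<bar>t n\<bar> * \<delta> \<le> norm (x n)" using far[of v] by (simp add: mult_left_mono)
      then show ?thesis using M[of n] \<delta>(1) by (simp add: field_simps)
    qed
    then have "bounded (range t)" unfolding bounded_iff by blast
    then obtain s r where r: "strict_mono r" "(\<lambda>n. t (r n)) \<longlonglongrightarrow> s"
      using bounded_imp_convergent_subsequence[of t] by (auto simp: o_def)
    have "bounded (range (\<lambda>n. x (r n) - t (r n) *\<^sub>R b))"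
      unfolding bounded_iff
    proof (intro exI ballI)
      fix y assume "y \<in> range (\<lambda>n. x (r n) - t (r n) *\<^sub>R b)"
      then obtain n where y: "y = x (r n) - t (r n) *\<^sub>R b" by blast
      have "norm y \<le> norm (x (r n)) + norm (t (r n) *\<^sub>R b)" unfolding y by (rule norm_triangle_ineq4)
      also have "\<dots> \<le> M + (M / \<delta>) * norm b"
        unfolding norm_scaleR using t_le[of "r n"] by (intro add_mono M mult_right_mono) auto
      finally show "norm y \<le> M + (M / \<delta>) * norm b" .
    qed
    then obtain l r' where l: "l \<in> span B" "strict_mono r'" "(\<lambda>n. x (r (r' n)) - t (r (r' n)) *\<^sub>R b) \<longlonglongrightarrow> l"
      using insert.IH[of "\<lambda>n. x (r n) - t (r n) *\<^sub>R b"] t by auto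
    have "(\<lambda>n. t (r (r' n))) \<longlonglongrightarrow> s" using LIMSEQ_subseq_LIMSEQ[OF r(2) l(2)] by (simp add: o_def)
    then have "(\<lambda>n. (x (r (r' n)) - t (r (r' n)) *\<^sub>R b) + t (r (r' n)) *\<^sub>R b) \<longlonglongrightarrow> l + s *\<^sub>R b"
      by (intro tendsto_intros l(3))
    then have "(\<lambda>n. x ((r \<circ> r') n)) \<longlonglongrightarrow> l + s *\<^sub>R b" by simp
    moreover have "strict_mono (r \<circ> r')" using r(1) l(2) by (rule strict_mono_o)
    moreover have "l + s *\<^sub>R b \<in> span (insert b B)"
      using l(1) by (simp add: span_breakdown_eq exI[of _ s])
    ultimately show ?thesis by blast
  qed
qed

lemma is_norm_pair_le:
  fixes Z :: "real \<times> real \<Rightarrow> real"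
  assumes Z: "is_norm Z"
  shows "Z (x, y) \<le> \<bar>x\<bar> * Z (1, 0) + \<bar>y\<bar> * Z (0, 1)"
proof -
  have "Z ((x, 0) + (0, y)) \<le> Z (x, 0) + Z (0, y)" using Z unfolding is_norm_def by blast
  moreover have "Z (x *\<^sub>R (1, 0)) = \<bar>x\<bar> * Z (1, 0)" "Z (y *\<^sub>R (0, 1)) = \<bar>y\<bar> * Z (0, 1)"
    using Z unfolding is_norm_def by blast+
  ultimately show ?thesis by simp
qed

lemma is_norm_unit_pos:
  fixes Z :: "real \<times> real \<Rightarrow> real"
  assumes "is_norm Z"
  shows "0 < Z (1, 0)" and "0 < Z (0, 1)"
proof -
  have "0 \<le> Z p" "Z p = 0 \<longleftrightarrow> p = 0" for p using assms unfolding is_norm_def by blast+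
  from this[of "(1, 0)"] this[of "(0, 1)"] show "0 < Z (1, 0)" "0 < Z (0, 1)" by (auto simp: zero_prod_def less_le)
qed

text \<open>
  Strict monotonicity in the second coordinate, made uniform on bounded sets by compactness.
\<close>
lemma strictly_monotone_uniform:
  fixes Z :: "real \<times> real \<Rightarrow> real"
  assumes Z: "is_norm Z" and mono: "strictly_monotone Z" and \<epsilon>: "0 < \<epsilon>"
  shows "\<exists>\<eta>>0. \<forall>r\<in>{0..R}. \<forall>s\<in>{0..R}. \<forall>t\<in>{0..R}. Z (r, t) \<le> Z (r, s) + \<eta> \<longrightarrow> t \<le> s + \<epsilon>"
proof -
  define P where "P = ({0..R} \<times> {0..R} \<times> {0..R}) \<inter> {p. fst (snd p) + \<epsilon> \<le> snd (snd p)}"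
  define g where "g p = Z (fst p, snd (snd p)) - Z (fst p, fst (snd p))" for p :: "real \<times> real \<times> real"
  have "Z p \<le> (Z (1, 0) + Z (0, 1)) * norm p" for p
  proof -
    have "Z p \<le> \<bar>fst p\<bar> * Z (1, 0) + \<bar>snd p\<bar> * Z (0, 1)"
      using is_norm_pair_le[OF Z, of "fst p" "snd p"] by simp
    also have "\<dots> \<le> norm p * Z (1, 0) + norm p * Z (0, 1)"
      using is_norm_unit_pos[OF Z] norm_fst_le[of "fst p" "snd p"] norm_snd_le[of "snd p" "fst p"]
      by (intro add_mono mult_right_mono) auto
    finally show ?thesis by (simp add: algebra_simps)
  qed
  note cont = continuous_on_is_norm[OF Z this]
  have "compact P"
    unfolding P_def
    by (intro compact_Int_closed compact_Times compact_Icc closed_Collect_le continuous_intros)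
  moreover have "continuous_on P g"
    unfolding g_def by (intro continuous_on_diff cont continuous_intros)
  ultimately obtain \<mu> where \<mu>: "0 < \<mu>" "\<And>p. p \<in> P \<Longrightarrow> \<mu> \<le> g p"
  proof (cases "P = {}")
    case False
    with \<open>compact P\<close> \<open>continuous_on P g\<close> obtain p where p: "p \<in> P" "\<forall>q\<in>P. g p \<le> g q"
      using continuous_attains_inf by blast
    obtain r s t where rst: "p = (r, s, t)" using prod_cases3 by blast
    have "0 \<le> r" "0 \<le> s" "s < t" using p(1) \<epsilon> by (auto simp: P_def rst)
    then have "0 < g p"
      using mono[unfolded strictly_monotone_def, rule_format, of r r s t] by (simp add: g_def rst)
    with p(2) that show thesis by blast
  qed (use that[of 1] in auto)
  have "t \<le> s + \<epsilon>" if "r \<in> {0..R}" "s \<in> {0..R}" "t \<in> {0..R}" "Z (r, t) \<le> Z (r, s) + \<mu> / 2" for r s t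
  proof (rule ccontr)
    assume "\<not> t \<le> s + \<epsilon>"
    then have "(r, s, t) \<in> P" using that by (simp add: P_def)
    from \<mu>(2)[OF this] that(4) \<mu>(1) show False by (simp add: g_def)
  qed
  with \<mu>(1) show ?thesis by (intro exI[of _ "\<mu> / 2"]) auto
qed

lemma direct_sum_norm_bounds:
  fixes Z :: "real \<times> real \<Rightarrow> real" and p :: "'a::real_normed_vector \<times> 'b::real_normed_vector"
  assumes Z: "is_norm Z" and mono: "strictly_monotone Z"
  shows "Z (1, 0) * norm (fst p) \<le> direct_sum_norm Z p"
    and "Z (0, 1) * norm (snd p) \<le> direct_sum_norm Z p"
    and "direct_sum_norm Z p \<le> (Z (1, 0) + Z (0, 1)) * norm p"
proof -
  have Zs: "Z (c *\<^sub>R q) = \<bar>c\<bar> * Z q" for c q using Z unfolding is_norm_def by blast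
  show "Z (1, 0) * norm (fst p) \<le> direct_sum_norm Z p"
    using Zs[of "norm (fst p)" "(1, 0)"] direct_sum_norm_mono[OF mono, of "norm (fst p)" "norm (fst p)" 0 "norm (snd p)"]
    by (simp add: direct_sum_norm_def split_beta mult.commute)
  show "Z (0, 1) * norm (snd p) \<le> direct_sum_norm Z p"
    using Zs[of "norm (snd p)" "(0, 1)"] direct_sum_norm_mono[OF mono, of 0 "norm (fst p)" "norm (snd p)" "norm (snd p)"]
    by (simp add: direct_sum_norm_def split_beta mult.commute)
  have "direct_sum_norm Z p \<le> norm (fst p) * Z (1, 0) + norm (snd p) * Z (0, 1)"
    using is_norm_pair_le[OF Z, of "norm (fst p)" "norm (snd p)"] by (simp add: direct_sum_norm_def split_beta)
  also have "\<dots> \<le> norm p * Z (1, 0) + norm p * Z (0, 1)"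
    using is_norm_unit_pos[OF Z] norm_fst_le[of "fst p" "snd p"] norm_snd_le[of "snd p" "fst p"]
    by (intro add_mono mult_right_mono) auto
  finally show "direct_sum_norm Z p \<le> (Z (1, 0) + Z (0, 1)) * norm p" by (simp add: algebra_simps)
qed

lemma equivalent_norm_direct_sum:
  fixes Z :: "real \<times> real \<Rightarrow> real"
  assumes Z: "is_norm Z" and mono: "strictly_monotone Z"
  shows "equivalent_norm (direct_sum_norm Z :: 'a::real_normed_vector \<times> 'b::real_normed_vector \<Rightarrow> real)
    (1 / (1 / Z (1, 0) + 1 / Z (0, 1))) (Z (1, 0) + Z (0, 1))"
proof
  let ?N = "direct_sum_norm Z :: 'a \<times> 'b \<Rightarrow> real"
  note pos = is_norm_unit_pos[OF Z]
  show "is_norm ?N" by (rule is_norm_direct_sum_norm[OF assms])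
  show "0 < 1 / (1 / Z (1, 0) + 1 / Z (0, 1))" using pos by (simp add: add_pos_pos)
  fix p :: "'a \<times> 'b"
  show "?N p \<le> (Z (1, 0) + Z (0, 1)) * norm p" by (rule direct_sum_norm_bounds[OF assms])
  have "norm p \<le> norm (fst p) + norm (snd p)"
    using norm_Pair_le[of "fst p" "snd p"] by simp
  also have "\<dots> \<le> ?N p / Z (1, 0) + ?N p / Z (0, 1)"
    using direct_sum_norm_bounds(1,2)[OF assms, of p] pos by (intro add_mono) (simp_all add: pos_le_divide_eq mult.commute)
  also have "\<dots> = ?N p * (1 / Z (1, 0) + 1 / Z (0, 1))" by (simp add: algebra_simps)
  finally show "1 / (1 / Z (1, 0) + 1 / Z (0, 1)) * norm p \<le> ?N p"
    using pos by (simp add: pos_divide_le_eq add_pos_pos)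
qed

text \<open>
  In the norm of \<open>y - x\<close>, the first coordinate may be replaced by the length of the detour through \<open>z\<close>,
  since \<open>Z\<close> is monotone.  This leaves two vectors of the plane with the same first coordinate, so
  that uniform strict monotonicity compares their second coordinates.
\<close>
lemma direct_sum_norm_monotone_metric:
  fixes x y z :: "'a::real_normed_vector \<times> 'b::real_normed_vector"
  assumes Z: "is_norm Z" and mono: "strictly_monotone Z"
    and \<eta>: "direct_sum_norm Z (z - x) + direct_sum_norm Z (z - y) \<le> direct_sum_norm Z (y - x) + \<eta>"
  shows "Z (norm (fst (z - x)) + norm (fst (z - y)), norm (snd (z - x)) + norm (snd (z - y)))
    \<le> Z (norm (fst (z - x)) + norm (fst (z - y)), norm (snd (y - x))) + \<eta>"
proof -
  let ?r = "norm (fst (z - x)) + norm (fst (z - y))"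
  have "Z ((norm (fst (z - x)), norm (snd (z - x))) + (norm (fst (z - y)), norm (snd (z - y))))
    \<le> Z (norm (fst (z - x)), norm (snd (z - x))) + Z (norm (fst (z - y)), norm (snd (z - y)))"
    using Z unfolding is_norm_def by blast
  then have "Z (?r, norm (snd (z - x)) + norm (snd (z - y))) \<le> direct_sum_norm Z (y - x) + \<eta>"
    using \<eta> by (simp add: direct_sum_norm_def split_beta)
  also have "direct_sum_norm Z (y - x) \<le> Z (?r, norm (snd (y - x)))"
  proof -
    have "norm (fst (y - x)) \<le> ?r"
      using norm_triangle_ineq4[of "fst (z - x)" "fst (z - y)"] by simp
    then show ?thesis
      unfolding direct_sum_norm_def split_beta by (intro direct_sum_norm_mono[OF mono]) auto
  qed
  finally show ?thesis by simp
qed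

lemma compactin_weak_fst_image:
  assumes N: "is_norm N" and c: "\<And>p. c * norm (fst p) \<le> N p" "0 < c"
    and K: "compactin (weak_topology N) (K :: ('a::real_normed_vector \<times> 'b::real_normed_vector) set)"
  shows "compactin (weak_topology norm) (fst ` K)"
proof (rule image_compactin[OF K])
  have norm: "is_norm (norm :: 'a \<Rightarrow> real)" by (auto simp: is_norm_def norm_triangle_ineq)
  have "openin (weak_topology N) (fst -` (f -` U))" if f: "f \<in> dual_space norm" and U: "open U" for f :: "'a \<Rightarrow> real" and U
  proof -
    obtain B where B: "linear f" "\<And>x. \<bar>f x\<bar> \<le> B * norm x" using f by (auto simp: dual_space_def)
    have "\<bar>(f \<circ> fst) p\<bar> \<le> (\<bar>B\<bar> / c) * N p" for p
    proof -
      have "\<bar>(f \<circ> fst) p\<bar> \<le> B * norm (fst p)" using B(2) by simp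
      also have "\<dots> \<le> \<bar>B\<bar> * norm (fst p)" by (intro mult_right_mono) auto
      also have "\<dots> \<le> \<bar>B\<bar> * (N p / c)" using c(1)[of p] c(2) by (intro mult_left_mono) (auto simp: field_simps)
      finally show ?thesis by simp
    qed
    moreover have "linear (f \<circ> fst)" using linear_fst B(1) by (rule linear_compose)
    ultimately have "f \<circ> fst \<in> dual_space N" unfolding dual_space_def mem_Collect_eq by (intro conjI exI allI)
    then show ?thesis
      unfolding weak_topology_def vimage_comp
      by (intro topology_generated_by_Basis CollectI exI[of _ "f \<circ> fst"] exI[of _ U] conjI refl U)
  qed
  then show "continuous_map (weak_topology N) (weak_topology norm) fst"
    using topspace_weak_topology[OF norm] topspace_weak_topology[OF N]
    unfolding weak_topology_def[of norm] continuous_on_generated_topo_iff by auto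
qed

theorem corollary4p3:
  fixes Z :: "real \<times> real \<Rightarrow> real"
  assumes "is_norm Z" and "strictly_monotone Z"
    and "wfpp (norm :: 'a::banach \<Rightarrow> real)"
    and "\<exists>B :: 'b::banach set. finite B \<and> span B = UNIV"
  shows "wfpp (direct_sum_norm Z :: 'a \<times> 'b \<Rightarrow> real)"
  unfolding wfpp_def
proof (intro allI impI; elim conjE)
  let ?N = "direct_sum_norm Z :: 'a \<times> 'b \<Rightarrow> real"
  fix C :: "('a \<times> 'b) set" and T
  assume C: "C \<noteq> {}" "convex C" "compactin (weak_topology ?N) C" and T: "T \<in> C \<rightarrow> C" "nonexpansive_on ?N C T"
  note Z = assms(1,2)
  interpret E: equivalent_norm ?N "1 / (1 / Z (1, 0) + 1 / Z (0, 1))" "Z (1, 0) + Z (0, 1)"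
    by (rule equivalent_norm_direct_sum[OF Z])
  obtain K where K: "K \<subseteq> C" "E.minimal_invariant T K"
    using E.minimal_invariant_exists[OF C(3,2,1) T(1)] by blast
  interpret minimal_nonexpansive ?N "1 / (1 / Z (1, 0) + 1 / Z (0, 1))" "Z (1, 0) + Z (0, 1)" T K
  proof
    show "nonexpansive_on ?N K T" using T(2) K(1) by (auto simp: nonexpansive_on_def)
    show "E.minimal_invariant T K" by fact
    have "closed K" "convex K" using K(2) by (simp_all add: E.minimal_invariant_def)
    then show "compactin (weak_topology ?N) K"
      using closed_compactin[OF C(3) K(1)] E.closed_convex_imp_weakly_closed by blast
  qed
  obtain B where B: "\<forall>x\<in>K. norm x \<le> B"
    using E.weakly_compact_imp_bounded[OF weakly_compact] unfolding bounded_iff by blast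
  have "\<exists>w. w \<in> K \<and> ?N (T w - w) < 1 / real (Suc n)" for n
    using approximate_fixed_point[of "1 / real (Suc n)"] by auto
  then obtain w where w: "\<And>n. w n \<in> K" "\<And>n. ?N (T (w n) - w n) < 1 / real (Suc n)" by metis
  obtain F :: "'b set" where F: "finite F" "span F = UNIV" using assms(4) by blast
  have "bounded (range (\<lambda>n. snd (w n)))"
    unfolding bounded_iff
  proof (intro exI ballI)
    fix y assume "y \<in> range (\<lambda>n. snd (w n))"
    then obtain n where "y = snd (w n)" by blast
    then show "norm y \<le> B" using norm_snd_le[of "snd (w n)" "fst (w n)"] bspec[OF B w(1)[of n]] by simp
  qed
  then obtain y r where y: "strict_mono r" "(\<lambda>n. snd (w (r n))) \<longlonglongrightarrow> y"
    using finite_span_convergent_subsequence[of F "\<lambda>n. snd (w n)"] F by auto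
  have K_slice: "snd p = y" if "p \<in> K" for p
  proof -
    have "norm (snd (p - (0, y))) = 0"
    proof (rule seminorm_vanishes_on_minimal_set[where \<rho> = "\<lambda>p. norm (snd p)" and \<beta> = "1 / Z (0, 1)", OF _ _ _ _ _ _ that])
      fix x x' :: "'a \<times> 'b"
      show "norm (snd (x + x')) \<le> norm (snd x) + norm (snd x')" by (simp add: norm_triangle_ineq)
      show "norm (snd (- x)) = norm (snd x)" by simp
      show "0 \<le> norm (snd x)" by simp
      show "norm (snd x) \<le> 1 / Z (0, 1) * ?N x"
        using direct_sum_norm_bounds(2)[OF Z, of x] is_norm_unit_pos[OF Z(1)] by (simp add: field_simps)
    next
      fix \<epsilon> :: real assume "0 < \<epsilon>"
      \<comment> \<open>Differences of points of \<open>K\<close> have norm at most \<open>2 * B\<close>, and sums of two such norms occur below.\<close>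
      then obtain \<eta> where \<eta>: "\<eta> > 0" "\<forall>r\<in>{0..4 * B}. \<forall>s\<in>{0..4 * B}. \<forall>t\<in>{0..4 * B}. Z (r, t) \<le> Z (r, s) + \<eta> \<longrightarrow> t \<le> s + \<epsilon>"
        using strictly_monotone_uniform[OF Z] by blast
      have bd: "norm (fst (u - v)) \<le> 2 * B" "norm (snd (u - v)) \<le> 2 * B" if "u \<in> K" "v \<in> K" for u v
      proof -
        have "norm (u - v) \<le> 2 * B"
          using norm_triangle_ineq4[of u v] bspec[OF B that(1)] bspec[OF B that(2)] by simp
        then show "norm (fst (u - v)) \<le> 2 * B" "norm (snd (u - v)) \<le> 2 * B"
          using norm_fst_le[of "fst (u - v)" "snd (u - v)"] norm_snd_le[of "snd (u - v)" "fst (u - v)"]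
          by (simp_all del: fst_diff snd_diff)
      qed
      have "norm (snd (z - v)) \<le> norm (snd (x - v)) + \<epsilon>"
        if K: "x \<in> K" "z \<in> K" "v \<in> K" and le: "?N (z - x) + ?N (z - v) \<le> ?N (v - x) + \<eta>" for x z v
      proof -
        let ?r = "norm (fst (z - x)) + norm (fst (z - v))" and ?t = "norm (snd (z - x)) + norm (snd (z - v))"
        have "Z (?r, ?t) \<le> Z (?r, norm (snd (v - x))) + \<eta>"
          by (rule direct_sum_norm_monotone_metric[OF Z le])
        moreover have "?r \<in> {0..4 * B}" "?t \<in> {0..4 * B}" "norm (snd (v - x)) \<in> {0..4 * B}"
          using bd[OF K(2,1)] bd[OF K(2,3)] bd[OF K(3,1)] norm_ge_zero[of "snd (v - x)"]
          unfolding atLeastAtMost_iff by (smt (verit) norm_ge_zero)+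
        ultimately have "?t \<le> norm (snd (v - x)) + \<epsilon>" using \<eta>(2) by blast
        then show ?thesis
          using norm_ge_zero[of "snd (z - x)"] norm_minus_commute[of "snd v" "snd x"]
          unfolding snd_diff by linarith
      qed
      with \<eta>(1) show "\<exists>\<eta>>0. \<forall>x\<in>K. \<forall>z\<in>K. \<forall>v\<in>K. ?N (z - x) + ?N (z - v) \<le> ?N (v - x) + \<eta> \<longrightarrow>
          norm (snd (z - v)) \<le> norm (snd (x - v)) + \<epsilon>"
        by blast
    next
      fix \<delta> :: real assume \<delta>: "0 < \<delta>"
      have "\<forall>\<^sub>F n in sequentially. dist (snd (w (r n))) y < \<delta>" using y(2) \<delta> by (rule tendstoD)
      moreover have "\<forall>\<^sub>F n in sequentially. inverse (real (Suc n)) < \<delta>"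
        using LIMSEQ_inverse_real_of_nat \<delta> by (rule order_tendstoD(2))
      ultimately have "\<forall>\<^sub>F n in sequentially. dist (snd (w (r n))) y < \<delta> \<and> inverse (real (Suc n)) < \<delta>"
        by (rule eventually_conj)
      then obtain n where n: "dist (snd (w (r n))) y < \<delta>" "inverse (real (Suc n)) < \<delta>"
        using eventually_happens'[OF sequentially_bot] by blast
      have "?N (T (w (r n)) - w (r n)) < 1 / real (Suc (r n))" by (rule w)
      also have "\<dots> \<le> 1 / real (Suc n)" using seq_suble[OF y(1), of n] by (intro divide_left_mono) auto
      also have "\<dots> < \<delta>" using n(2) by (simp add: inverse_eq_divide)
      finally show "\<exists>w\<in>K. ?N (T w - w) < \<delta> \<and> norm (snd (w - (0, y))) < \<delta>"
        using n(1) w(1) by (intro bexI[of _ "w (r n)"]) (auto simp: dist_norm)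
    qed
    then show ?thesis by simp
  qed
  \<comment> \<open>The restriction of \<open>T\<close> to the slice, as a self-map of a set in \<open>X\<close>.\<close>
  define S where "S x = fst (T (x, y))" for x
  have lift: "(x, y) \<in> K" if "x \<in> fst ` K" for x
    using that K_slice by (metis imageE prod.collapse)
  have "\<exists>x\<in>fst ` K. S x = x"
  proof -
    have "fst ` K \<noteq> {}" using nonempty by simp
    moreover have "convex (fst ` K)" using linear_fst convex_K by (rule convex_linear_image)
    moreover have "compactin (weak_topology norm) (fst ` K)"
      using is_norm_direct_sum_norm[OF Z] direct_sum_norm_bounds(1)[OF Z] is_norm_unit_pos(1)[OF Z(1)] weakly_compact
      by (rule compactin_weak_fst_image)
    moreover have "S \<in> fst ` K \<rightarrow> fst ` K" using lift T_in by (auto simp: S_def)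
    moreover have "nonexpansive_on norm (fst ` K) S"
      unfolding nonexpansive_on_def
    proof (intro ballI)
      fix x x' assume x: "x \<in> fst ` K" "x' \<in> fst ` K"
      have "Z (1, 0) * norm (S x - S x') \<le> ?N (T (x, y) - T (x', y))"
        using direct_sum_norm_bounds(1)[OF Z, of "T (x, y) - T (x', y)"] by (simp add: S_def)
      also have "\<dots> \<le> ?N ((x, y) - (x', y))" using x lift by (intro T_nonexpansive)
      also have "\<dots> \<le> norm (x - x') * Z (1, 0)"
        using is_norm_pair_le[OF Z(1), of "norm (x - x')" 0] by (simp add: direct_sum_norm_def)
      finally show "norm (S x - S x') \<le> norm (x - x')"
        using is_norm_unit_pos(1)[OF Z(1)] by (simp add: mult.commute)
    qed
    ultimately show ?thesis
      by (intro assms(3)[unfolded wfpp_def, rule_format, of "fst ` K" S] conjI)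
  qed
  then obtain x where x: "x \<in> fst ` K" "S x = x" by blast
  have "T (x, y) = (x, y)"
    using x(2) K_slice[OF T_in[OF lift[OF x(1)]]] by (simp add: S_def prod_eq_iff)
  with lift[OF x(1)] K(1) show "\<exists>p\<in>C. T p = p" by blast
qed

end
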